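(* Let $(\mathscr{C},\mathbb{E},\mathfrak{s})$ be a skeletally small Krull–Schmidt extriangulated category with enough projectives and enough injectives satisfying Condition (WIC). The mutually inverse bijections $\mathcal{T}\mapsto({}^{\perp_1}\mathrm{Defl}(\mathcal{T}),\mathrm{Defl}(\mathcal{T}))$ and $(\mathcal{U},\mathcal{V})\mapsto\mathcal{U}\cap\mathcal{V}$ between the support $\tau$-tilting subcategories of $\mathscr{C}$ and the $\tau$-cotorsion pairs $(\mathcal{U},\mathcal{V})$ in $\mathscr{C}$ with $\mathcal{V}$ a torsion class induce (by restriction) mutually inverse bijections between the tilting subcategories of $\mathscr{C}$ and the cotorsion pairs $(\mathcal{U},\mathcal{V})$ in $\mathscr{C}$ with $\mathcal{V}$ a torsion class.
   Context: Subcategories are full and closed under isomorphisms. $\mathscr{C}(A,B)$ is the set of morphisms $A\to B$; $ba$ means first $a$, then $b$. Extriangulated categories (Nakaoka–Palu). Let $\mathscr{C}$ be an additive category and $\mathbb{E}:\mathscr{C}^{op}\times\mathscr{C}\to Ab$ a biadditive functor. Elements $\delta\in\mathbb{E}(C,A)$ are called $\mathbb{E}$-extensions; for $a:A\to A'$, $c:C'\to C$ put $a_*\delta=\mathbb{E}(C,a)(\delta)$, $c^*\delta=\mathbb{E}(c,A)(\delta)$. A morphism $\delta\to\delta'$ (with $\delta\in\mathbb{E}(C,A)$, $\delta'\in\mathbb{E}(C',A')$) is a pair $(a,c)$, $a:A\to A'$, $c:C\to C'$, with $a_*\delta=c^*\delta'$. Sequences $A\xrightarrow{x}B\xrightarrow{y}C$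 and $A\xrightarrow{x'}B'\xrightarrow{y'}C$ are equivalent if there is an isomorphism $b:B\to B'$ with $bx=x'$, $y'b=y$. A realization $\mathfrak{s}$ assigns to each $\delta\in\mathbb{E}(C,A)$ an equivalence class $\mathfrak{s}(\delta)=[A\xrightarrow{x}B\xrightarrow{y}C]$ such that for every morphism $(a,c):\delta\to\delta'$ with $\mathfrak{s}(\delta')=[A'\xrightarrow{x'}B'\xrightarrow{y'}C']$ there is $b:B\to B'$ with $bx=x'a$, $y'b=cy$. It is additive if $\mathfrak{s}(0)=[A\to A\oplus C\to C]$ (canonical inclusion and projection) and $\mathfrak{s}(\delta\oplus\delta')=\mathfrak{s}(\delta)\oplus\mathfrak{s}(\delta')$. The triple $(\mathscr{C},\mathbb{E},\mathfrak{s})$ is extriangulated if: (ET1) $\mathbb{E}$ is biadditive; (ET2) $\mathfrak{s}$ is an additive realization; (ET3) if $\delta,\delta'$ are realized by $A\xrightarrow{x}B\xrightarrow{y}C$, $A'\xrightarrow{x'}B'\xrightarrow{y'}C'$ and $bx=x'a$, there is $c:C\to C'$ with $(a,c):\delta\to\delta'$ a morphism and $cy=y'b$; (ET3)$^{op}$ the dual of (ET3); (ET4) if $\delta\in\mathbb{E}(D,A)$, $\delta'\in\mathbb{E}(F,B)$ are realized by $A\xrightarrow{f}B\xrightarrow{f'}D$ and $B\xrightarrow{g}C\xrightarrow{g'}F$, there are an object $E$, morphisms $h=gf:A\to C$, $h':C\to E$, $d:D\to E$, $e:E\to F$ with $h'g=df'$, $eh'=g'$, and $\delta''\in\mathbb{E}(E,A)$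 realized by $A\xrightarrow{h}C\xrightarrow{h'}E$, such that $D\xrightarrow{d}E\xrightarrow{e}F$ realizes $f'_*\delta'$, $d^*\delta''=\delta$ and $f_*\delta''=e^*\delta'$; (ET4)$^{op}$ the dual of (ET4). A sequence $A\xrightarrow{x}B\xrightarrow{y}C$ realizing some $\delta\in\mathbb{E}(C,A)$ is a conflation; then $x$ is an inflation and $y$ a deflation. $P$ is projective if $\mathscr{C}(P,y)$ is surjective for every deflation $y$; $\mathcal{P}(\mathscr{C})$ is the subcategory of projective objects; injective objects are defined dually. $\mathscr{C}$ has enough projectives if every object $A$ admits a deflation $P\to A$ with $P$ projective, and enough injectives if every $A$ admits an inflation $A\to I$ with $I$ injective. Condition (WIC): for all $f:X\to Y$, $g:Y\to Z$, if $gf$ is an inflation then so is $f$; if $gf$ is a deflation then so is $g$. A morphism $f$ is compatible if "$f$ is both an inflation and a deflation" implies that $f$ is an isomorphism. A sequence $A\xrightarrow{x}B\xrightarrow{y}C$ is a right exact $\mathbb{E}$-triangle if there are a conflation $K\xrightarrow{h_2}B\xrightarrow{y}C$ and a compatible deflation $h_1:A\to K$ with $x=h_2h_1$. A morphism $f:P\to X$ is a left $\mathcal{X}$-approximation of $P$ if $X\in\mathcal{X}$ and $\mathscr{C}(f,X'):\mathscr{C}(X,X')\to\mathscr{C}(P,X')$ is surjective for every $X'\in\mathcal{X}$. $\mathrm{Defl}(\mathcal{U})=\{F\in\mathscr{C}\mid \text{there is a deflation } U\to F \text{ with } U\in\mathcal{U}\}$. $\mathcal{U}$ is closed under deflations if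 $\mathrm{Defl}(\mathcal{U})=\mathcal{U}$, and closed under extensions if for each conflation $A\to B\to C$ with $A,C\in\mathcal{U}$ one has $B\in\mathcal{U}$. A torsion class is a subcategory closed under extensions and deflations. ${}^{\perp_1}\mathcal{V}=\{X\mid\mathbb{E}(X,V)=0\text{ for all }V\in\mathcal{V}\}$. $\mathbb{E}(\mathcal{U},\mathcal{V})=0$ means $\mathbb{E}(U,V)=0$ for all $U\in\mathcal{U}$, $V\in\mathcal{V}$. $\mathcal{U}$ is a generator of $\mathcal{V}$ if $\mathcal{U}\subseteq\mathcal{V}$ and for every $V\in\mathcal{V}$ there is a conflation $V'\to U\to V$ with $U\in\mathcal{U}$, $V'\in\mathcal{V}$. A projective resolution of $A$ is a sequence $\cdots\to P_1\to P_0\to A$ with all $P_i$ projective, obtained by splicing conflations $K_{1}\to P_0\to A$, $K_{i+1}\to P_i\to K_i$ ($i\geqslant1$). $\mathrm{pd}(A)$ is the minimal length of a projective resolution of $A$ ($+\infty$ if all are of infinite length), and $\mathrm{pd}(\mathcal{T})=\sup\{\mathrm{pd}(T)\mid T\in\mathcal{T}\}$. A tilting subcategory is a subcategory $\mathcal{T}$, closed under direct summands and finite direct sums, such that: (T1) $\mathrm{pd}(\mathcal{T})\leqslant1$; (T2$'$) $\mathbb{E}(\mathcal{T},\mathcal{T})=0$; (T3) for every $P\in\mathcal{P}(\mathscr{C})$ there is a conflation $P\to T_0\to T_1$ with $T_0,T_1\in\mathcal{T}$. A support $\tau$-tilting subcategory is a subcategory $\mathcal{T}$, closed under direct summands and finite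 direct sums, such that: (ST1) $\mathcal{T}$ is a generator of $\mathrm{Defl}(\mathcal{T})$; (ST2) $\mathbb{E}(\mathcal{T},\mathrm{Defl}(\mathcal{T}))=0$; (ST3) for every $P\in\mathcal{P}(\mathscr{C})$ there is a right exact $\mathbb{E}$-triangle $P\xrightarrow{f}T^0\to T^1$ with $T^0,T^1\in\mathcal{T}$ and $f$ a left $\mathcal{T}$-approximation of $P$. A pair $(\mathcal{U},\mathcal{V})$ of subcategories closed under direct summands is a cotorsion pair if: (1) $\mathbb{E}(\mathcal{U},\mathcal{V})=0$; (2) for every $C\in\mathscr{C}$ there is a conflation $V^C\to U^C\to C$ with $U^C\in\mathcal{U}$, $V^C\in\mathcal{V}$; (3) for every $C\in\mathscr{C}$ there is a conflation $C\to V_C\to U_C$ with $U_C\in\mathcal{U}$, $V_C\in\mathcal{V}$. A pair $(\mathcal{U},\mathcal{V})$ of subcategories is a $\tau$-cotorsion pair if: (1) $\mathcal{U}={}^{\perp_1}\mathcal{V}$; (2) for every $P\in\mathcal{P}(\mathscr{C})$ there is a right exact $\mathbb{E}$-triangle $P\xrightarrow{f}V\to U$ with $V\in\mathcal{U}\cap\mathcal{V}$, $U\in\mathcal{U}$ and $f$ a left $\mathcal{V}$-approximation of $P$.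
   Formalization: The larger correspondence (support τ-tilting subcategories with τ-cotorsion pairs, V torsion) is not asserted, as it can fail under the given definitions; what is stated is that the two maps restrict to mutually inverse bijections between tilting subcategories and cotorsion pairs with V torsion. *)

theory Defs
  imports "HOL-Algebra.Ideal" "HOL-Library.Extended_Nat"
begin

section \<open>Additive categories\<close>

text \<open>
  The objects and the arrows of a category form HOL sets, so every category below is small, in
  particular skeletally small. Composition is written in the order of function application:
  in \<open>b \<cdot> a\<close> the arrow \<open>a\<close> comes first.
\<close>

record ('o, 'm) category_data =
  Obj :: "'o set"
  Arr :: "'m set"
  src :: "'m \<Rightarrow> 'o"
  tgt :: "'m \<Rightarrow> 'o"
  ident :: "'o \<Rightarrow> 'm"
  comp :: "'m \<Rightarrow> 'm \<Rightarrow> 'm" (infixl \<open>\<cdot>\<index>\<close> 70)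

record ('o, 'm) preadditive_data = "('o, 'm) category_data" +
  hadd :: "'m \<Rightarrow> 'm \<Rightarrow> 'm" (infixl \<open>\<boxplus>\<index>\<close> 65)
  hzero :: "'o \<Rightarrow> 'o \<Rightarrow> 'm"

definition Hom :: "('o, 'm, 'z) category_data_scheme \<Rightarrow> 'o \<Rightarrow> 'o \<Rightarrow> 'm set" (\<open>Hom\<index>\<close>)
  where "Hom\<^bsub>\<C>\<^esub> A B = {f \<in> Arr \<C>. src \<C> f = A \<and> tgt \<C> f = B}"

locale category =
  fixes \<C> :: "('o, 'm, 'z) category_data_scheme" (structure)
  assumes src_in_Obj: "f \<in> Arr \<C> \<Longrightarrow> src \<C> f \<in> Obj \<C>"
    and tgt_in_Obj: "f \<in> Arr \<C> \<Longrightarrow> tgt \<C> f \<in> Obj \<C>"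
    and ident_in_Hom: "A \<in> Obj \<C> \<Longrightarrow> ident \<C> A \<in> Hom A A"
    and comp_in_Hom: "\<lbrakk>f \<in> Hom A B; g \<in> Hom B C\<rbrakk> \<Longrightarrow> g \<cdot> f \<in> Hom A C"
    and comp_ident: "f \<in> Hom A B \<Longrightarrow> f \<cdot> ident \<C> A = f"
    and ident_comp: "f \<in> Hom A B \<Longrightarrow> ident \<C> B \<cdot> f = f"
    and comp_assoc: "\<lbrakk>f \<in> Hom A B; g \<in> Hom B C; h \<in> Hom C D\<rbrakk>
      \<Longrightarrow> (h \<cdot> g) \<cdot> f = h \<cdot> (g \<cdot> f)"

context
  fixes \<C> :: "('o, 'm, 'z) category_data_scheme" (structure)
begin

definition iso_arrow :: "'m \<Rightarrow> bool"
  where "iso_arrow f \<longleftrightarrow> f \<in> Arr \<C> \<and> (\<exists>g \<in> Hom (tgt \<C> f) (src \<C> f).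
    g \<cdot> f = ident \<C> (src \<C> f) \<and> f \<cdot> g = ident \<C> (tgt \<C> f))"

definition isomorphic :: "'o \<Rightarrow> 'o \<Rightarrow> bool"
  where "isomorphic A B \<longleftrightarrow> (\<exists>f \<in> Hom A B. iso_arrow f)"

definition zero_object :: "'o \<Rightarrow> bool"
  where "zero_object Z \<longleftrightarrow> Z \<in> Obj \<C> \<and>
    (\<forall>A \<in> Obj \<C>. (\<exists>!f. f \<in> Hom A Z) \<and> (\<exists>!f. f \<in> Hom Z A))"

text \<open>Full subcategories closed under isomorphisms are identified with their sets of objects.\<close>

definition subcategory :: "'o set \<Rightarrow> bool"
  where "subcategory \<X> \<longleftrightarrow> \<X> \<subseteq> Obj \<C> \<and>
    (\<forall>X \<in> \<X>. \<forall>Y \<in> Obj \<C>. isomorphic X Y \<longrightarrow> Y \<in> \<X>)"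

definition left_approximation :: "'o set \<Rightarrow> 'o \<Rightarrow> 'm \<Rightarrow> 'o \<Rightarrow> bool"
  where "left_approximation \<X> P f X \<longleftrightarrow> f \<in> Hom P X \<and> X \<in> \<X> \<and>
    (\<forall>X' \<in> \<X>. (\<lambda>g. g \<cdot> f) ` Hom X X' = Hom P X')"

end

context
  fixes \<C> :: "('o, 'm, 'z) preadditive_data_scheme" (structure)
begin

text \<open>
  Abelian groups are the commutative groups of HOL-Algebra, which are written multiplicatively:
  \<open>\<otimes>\<close> is the sum and \<open>\<one>\<close> the zero element.
\<close>

definition hom_group :: "'o \<Rightarrow> 'o \<Rightarrow> 'm monoid"
  where "hom_group A B = \<lparr>carrier = Hom A B, mult = hadd \<C>, one = hzero \<C> A B\<rparr>"

definition End_ring :: "'o \<Rightarrow> 'm ring"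
  where "End_ring A = \<lparr>carrier = Hom A A, mult = comp \<C>, one = ident \<C> A,
    zero = hzero \<C> A A, add = hadd \<C>\<rparr>"

definition biproduct :: "'o \<Rightarrow> 'o \<Rightarrow> 'o \<Rightarrow> 'm \<Rightarrow> 'm \<Rightarrow> 'm \<Rightarrow> 'm \<Rightarrow> bool"
  where "biproduct A B S i j p q \<longleftrightarrow>
    A \<in> Obj \<C> \<and> B \<in> Obj \<C> \<and> S \<in> Obj \<C> \<and>
    i \<in> Hom A S \<and> j \<in> Hom B S \<and> p \<in> Hom S A \<and> q \<in> Hom S B \<and>
    p \<cdot> i = ident \<C> A \<and> q \<cdot> j = ident \<C> B \<and>
    p \<cdot> j = hzero \<C> B A \<and> q \<cdot> i = hzero \<C> A B \<and>
    (i \<cdot> p) \<boxplus> (j \<cdot> q) = ident \<C> S"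

definition finite_biproduct ::
    "nat \<Rightarrow> (nat \<Rightarrow> 'o) \<Rightarrow> 'o \<Rightarrow> (nat \<Rightarrow> 'm) \<Rightarrow> (nat \<Rightarrow> 'm) \<Rightarrow> bool"
  where "finite_biproduct n X S i p \<longleftrightarrow> S \<in> Obj \<C> \<and>
    (\<forall>k<n. X k \<in> Obj \<C> \<and> i k \<in> Hom (X k) S \<and> p k \<in> Hom S (X k)) \<and>
    (\<forall>k<n. \<forall>l<n. p k \<cdot> i l = (if k = l then ident \<C> (X k) else hzero \<C> (X l) (X k))) \<and>
    (\<Otimes>\<^bsub>hom_group S S\<^esub> k \<in> {..<n}. i k \<cdot> p k) = ident \<C> S"

definition closed_under_summands :: "'o set \<Rightarrow> bool"
  where "closed_under_summands \<X> \<longleftrightarrow>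
    (\<forall>A B S i j p q. biproduct A B S i j p q \<and> S \<in> \<X> \<longrightarrow> A \<in> \<X> \<and> B \<in> \<X>)"

definition closed_under_finite_sums :: "'o set \<Rightarrow> bool"
  where "closed_under_finite_sums \<X> \<longleftrightarrow> (\<forall>Z. zero_object \<C> Z \<longrightarrow> Z \<in> \<X>) \<and>
    (\<forall>A B S i j p q. biproduct A B S i j p q \<and> A \<in> \<X> \<and> B \<in> \<X> \<longrightarrow> S \<in> \<X>)"

end

text \<open>
  A not necessarily commutative ring is local if its non-units form a two-sided ideal; this
  excludes the zero ring.
\<close>

definition local_ring :: "('a, 'z) ring_scheme \<Rightarrow> bool"
  where "local_ring R \<longleftrightarrow> ring R \<and> ideal (carrier R - Units R) R"

definition krull_schmidt :: "('o, 'm, 'z) preadditive_data_scheme \<Rightarrow> bool"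
  where "krull_schmidt \<C> \<longleftrightarrow> (\<forall>A \<in> Obj \<C>. \<exists>n X i p. finite_biproduct \<C> n X A i p \<and>
    (\<forall>k<n. local_ring (End_ring \<C> (X k))))"

locale additive_category = category \<C>
  for \<C> :: "('o, 'm, 'z) preadditive_data_scheme" (structure) +
  assumes hom_comm_group: "\<lbrakk>A \<in> Obj \<C>; B \<in> Obj \<C>\<rbrakk> \<Longrightarrow> comm_group (hom_group \<C> A B)"
    and comp_hadd_left: "\<lbrakk>f \<in> Hom A B; f' \<in> Hom A B; g \<in> Hom B C\<rbrakk>
      \<Longrightarrow> g \<cdot> (f \<boxplus> f') = (g \<cdot> f) \<boxplus> (g \<cdot> f')"
    and comp_hadd_right: "\<lbrakk>f \<in> Hom A B; g \<in> Hom B C; g' \<in> Hom B C\<rbrakk>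
      \<Longrightarrow> (g \<boxplus> g') \<cdot> f = (g \<cdot> f) \<boxplus> (g' \<cdot> f)"
    and zero_object_exists: "\<exists>Z. zero_object \<C> Z"
    and biproduct_exists: "\<lbrakk>A \<in> Obj \<C>; B \<in> Obj \<C>\<rbrakk> \<Longrightarrow> \<exists>S i j p q. biproduct \<C> A B S i j p q"


section \<open>Extriangulated categories\<close>

text \<open>
  \<open>Ext \<C> C A\<close> is the group \<open>\<bbbE>(C, A)\<close>, and \<open>Emap \<C> c a\<close> is the map
  \<open>\<bbbE>(c, a) : \<bbbE>(C, A) \<rightarrow> \<bbbE>(C', A')\<close> for \<open>c : C' \<rightarrow> C\<close> and \<open>a : A \<rightarrow> A'\<close>. For an
  extension \<open>\<delta> \<in> \<bbbE>(C, A)\<close>, \<open>realization \<C> C A \<delta>\<close> is an equivalence class of sequences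
  \<open>A \<rightarrow> B \<rightarrow> C\<close>, each given by its pair of arrows. The groups \<open>\<bbbE>(C, A)\<close> need not be disjoint,
  which is why \<open>C\<close> and \<open>A\<close> are arguments of the operations on extensions.
\<close>

record ('o, 'm, 'e) extri_data = "('o, 'm) preadditive_data" +
  Ext :: "'o \<Rightarrow> 'o \<Rightarrow> 'e monoid"
  Emap :: "'m \<Rightarrow> 'm \<Rightarrow> 'e \<Rightarrow> 'e"
  realization :: "'o \<Rightarrow> 'o \<Rightarrow> 'e \<Rightarrow> ('m \<times> 'm) set"

context
  fixes \<C> :: "('o, 'm, 'e, 'z) extri_data_scheme" (structure)
begin

definition push :: "'o \<Rightarrow> 'm \<Rightarrow> 'e \<Rightarrow> 'e"
  where "push C a \<delta> = Emap \<C> (ident \<C> C) a \<delta>"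

definition pull :: "'o \<Rightarrow> 'm \<Rightarrow> 'e \<Rightarrow> 'e"
  where "pull A c \<delta> = Emap \<C> c (ident \<C> A) \<delta>"

definition ext_morphism :: "'o \<Rightarrow> 'o \<Rightarrow> 'e \<Rightarrow> 'o \<Rightarrow> 'o \<Rightarrow> 'e \<Rightarrow> 'm \<Rightarrow> 'm \<Rightarrow> bool"
  where "ext_morphism C A \<delta> C' A' \<delta>' a c \<longleftrightarrow>
    a \<in> Hom A A' \<and> c \<in> Hom C C' \<and> push C a \<delta> = pull A' c \<delta>'"

definition sequences :: "'o \<Rightarrow> 'o \<Rightarrow> ('m \<times> 'm) set"
  where "sequences A C = {(x, y). \<exists>B. x \<in> Hom A B \<and> y \<in> Hom B C}"

definition seq_equiv :: "'o \<Rightarrow> 'o \<Rightarrow> (('m \<times> 'm) \<times> ('m \<times> 'm)) set"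
  where "seq_equiv A C = {((x, y), (x', y')).
    (x, y) \<in> sequences A C \<and> (x', y') \<in> sequences A C \<and>
    (\<exists>b \<in> Hom (tgt \<C> x) (tgt \<C> x'). iso_arrow \<C> b \<and> b \<cdot> x = x' \<and> y' \<cdot> b = y)}"

definition realizes :: "'e \<Rightarrow> 'o \<Rightarrow> 'm \<Rightarrow> 'o \<Rightarrow> 'm \<Rightarrow> 'o \<Rightarrow> bool"
  where "realizes \<delta> A x B y C \<longleftrightarrow> A \<in> Obj \<C> \<and> C \<in> Obj \<C> \<and> \<delta> \<in> carrier (Ext \<C> C A) \<and>
    x \<in> Hom A B \<and> y \<in> Hom B C \<and> (x, y) \<in> realization \<C> C A \<delta>"

end

locale extriangulated_category = additive_category \<C>
  for \<C> :: "('o, 'm, 'e, 'z) extri_data_scheme" (structure) +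
  \<comment> \<open>(ET1)\<close>
  assumes Ext_comm_group: "\<lbrakk>C \<in> Obj \<C>; A \<in> Obj \<C>\<rbrakk> \<Longrightarrow> comm_group (Ext \<C> C A)"
    and Emap_hom: "\<lbrakk>c \<in> Hom C' C; a \<in> Hom A A'\<rbrakk>
      \<Longrightarrow> Emap \<C> c a \<in> hom (Ext \<C> C A) (Ext \<C> C' A')"
    and Emap_ident: "\<lbrakk>C \<in> Obj \<C>; A \<in> Obj \<C>; \<delta> \<in> carrier (Ext \<C> C A)\<rbrakk>
      \<Longrightarrow> Emap \<C> (ident \<C> C) (ident \<C> A) \<delta> = \<delta>"
    and Emap_comp: "\<lbrakk>c \<in> Hom C' C; c' \<in> Hom C'' C'; a \<in> Hom A A'; a' \<in> Hom A' A'';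
      \<delta> \<in> carrier (Ext \<C> C A)\<rbrakk>
      \<Longrightarrow> Emap \<C> (c \<cdot> c') (a' \<cdot> a) \<delta> = Emap \<C> c' a' (Emap \<C> c a \<delta>)"
    and pull_hadd: "\<lbrakk>c \<in> Hom C' C; c' \<in> Hom C' C; A \<in> Obj \<C>; \<delta> \<in> carrier (Ext \<C> C A)\<rbrakk>
      \<Longrightarrow> pull \<C> A (c \<boxplus> c') \<delta> = pull \<C> A c \<delta> \<otimes>\<^bsub>Ext \<C> C' A\<^esub> pull \<C> A c' \<delta>"
    and push_hadd: "\<lbrakk>a \<in> Hom A A'; a' \<in> Hom A A'; C \<in> Obj \<C>; \<delta> \<in> carrier (Ext \<C> C A)\<rbrakk>
      \<Longrightarrow> push \<C> C (a \<boxplus> a') \<delta> = push \<C> C a \<delta> \<otimes>\<^bsub>Ext \<C> C A'\<^esub> push \<C> C a' \<delta>"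
  \<comment> \<open>(ET2); the direct sum of \<open>\<delta> \<in> \<bbbE>(C, A)\<close> and \<open>\<delta>' \<in> \<bbbE>(C', A')\<close> is the element of
    \<open>\<bbbE>(C \<oplus> C', A \<oplus> A')\<close> with components \<open>\<delta>\<close>, \<open>0\<close>, \<open>0\<close>, \<open>\<delta>'\<close>.\<close>
    and realization_class: "\<lbrakk>C \<in> Obj \<C>; A \<in> Obj \<C>; \<delta> \<in> carrier (Ext \<C> C A)\<rbrakk>
      \<Longrightarrow> realization \<C> C A \<delta> \<in> sequences \<C> A C // seq_equiv \<C> A C"
    and realization_morphism: "\<lbrakk>realizes \<C> \<delta> A x B y C; realizes \<C> \<delta>' A' x' B' y' C';
      ext_morphism \<C> C A \<delta> C' A' \<delta>' a c\<rbrakk>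
      \<Longrightarrow> \<exists>b \<in> Hom B B'. b \<cdot> x = x' \<cdot> a \<and> y' \<cdot> b = c \<cdot> y"
    and realization_zero: "biproduct \<C> A C S i j p q
      \<Longrightarrow> realizes \<C> \<one>\<^bsub>Ext \<C> C A\<^esub> A i S q C"
    and realization_sum: "\<lbrakk>realizes \<C> \<delta> A x B y C; realizes \<C> \<delta>' A' x' B' y' C';
      biproduct \<C> A A' SA iA jA pA qA; biproduct \<C> B B' SB iB jB pB qB;
      biproduct \<C> C C' SC iC jC pC qC\<rbrakk>
      \<Longrightarrow> realizes \<C> (Emap \<C> pC iA \<delta> \<otimes>\<^bsub>Ext \<C> SC SA\<^esub> Emap \<C> qC jA \<delta>')
            SA ((iB \<cdot> x \<cdot> pA) \<boxplus> (jB \<cdot> x' \<cdot> qA))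
            SB ((iC \<cdot> y \<cdot> pB) \<boxplus> (jC \<cdot> y' \<cdot> qB)) SC"
    and ET3: "\<lbrakk>realizes \<C> \<delta> A x B y C; realizes \<C> \<delta>' A' x' B' y' C';
      a \<in> Hom A A'; b \<in> Hom B B'; b \<cdot> x = x' \<cdot> a\<rbrakk>
      \<Longrightarrow> \<exists>c. ext_morphism \<C> C A \<delta> C' A' \<delta>' a c \<and> c \<cdot> y = y' \<cdot> b"
    and ET3_op: "\<lbrakk>realizes \<C> \<delta> A x B y C; realizes \<C> \<delta>' A' x' B' y' C';
      b \<in> Hom B B'; c \<in> Hom C C'; y' \<cdot> b = c \<cdot> y\<rbrakk>
      \<Longrightarrow> \<exists>a. ext_morphism \<C> C A \<delta> C' A' \<delta>' a c \<and> x' \<cdot> a = b \<cdot> x"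
    and ET4: "\<lbrakk>realizes \<C> \<delta> A f B f' D; realizes \<C> \<delta>' B g C g' F\<rbrakk>
      \<Longrightarrow> \<exists>E h' d e \<delta>''. h' \<in> Hom C E \<and> d \<in> Hom D E \<and> e \<in> Hom E F \<and>
        h' \<cdot> g = d \<cdot> f' \<and> e \<cdot> h' = g' \<and>
        realizes \<C> \<delta>'' A (g \<cdot> f) C h' E \<and>
        realizes \<C> (push \<C> F f' \<delta>') D d E e F \<and>
        pull \<C> A d \<delta>'' = \<delta> \<and>
        push \<C> E f \<delta>'' = pull \<C> B e \<delta>'"
    and ET4_op: "\<lbrakk>realizes \<C> \<delta> D f' B f A; realizes \<C> \<delta>' F g' C g B\<rbrakk>
      \<Longrightarrow> \<exists>E h' d e \<delta>''. h' \<in> Hom E C \<and> d \<in> Hom E D \<and> e \<in> Hom F E \<and>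
        g \<cdot> h' = f' \<cdot> d \<and> h' \<cdot> e = g' \<and>
        realizes \<C> \<delta>'' E h' C (f \<cdot> g) A \<and>
        realizes \<C> (pull \<C> F f' \<delta>') F e E d D \<and>
        push \<C> A d \<delta>'' = \<delta> \<and>
        pull \<C> E f \<delta>'' = push \<C> B e \<delta>'"


section \<open>Tilting, support tau-tilting and cotorsion pairs\<close>

context
  fixes \<C> :: "('o, 'm, 'e, 'z) extri_data_scheme" (structure)
begin

definition conflation :: "'o \<Rightarrow> 'm \<Rightarrow> 'o \<Rightarrow> 'm \<Rightarrow> 'o \<Rightarrow> bool"
  where "conflation A x B y C \<longleftrightarrow> (\<exists>\<delta>. realizes \<C> \<delta> A x B y C)"

definition inflation :: "'m \<Rightarrow> bool"
  where "inflation x \<longleftrightarrow> (\<exists>A B y C. conflation A x B y C)"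

definition deflation :: "'m \<Rightarrow> bool"
  where "deflation y \<longleftrightarrow> (\<exists>A x B C. conflation A x B y C)"

definition projective :: "'o \<Rightarrow> bool"
  where "projective P \<longleftrightarrow> P \<in> Obj \<C> \<and>
    (\<forall>B C y. y \<in> Hom B C \<and> deflation y \<longrightarrow> (\<lambda>f. y \<cdot> f) ` Hom P B = Hom P C)"

definition injective :: "'o \<Rightarrow> bool"
  where "injective I \<longleftrightarrow> I \<in> Obj \<C> \<and>
    (\<forall>A B x. x \<in> Hom A B \<and> inflation x \<longrightarrow> (\<lambda>f. f \<cdot> x) ` Hom B I = Hom A I)"

definition enough_projectives :: bool
  where "enough_projectives \<longleftrightarrow>
    (\<forall>A \<in> Obj \<C>. \<exists>P. projective P \<and> (\<exists>y \<in> Hom P A. deflation y))"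

definition enough_injectives :: bool
  where "enough_injectives \<longleftrightarrow>
    (\<forall>A \<in> Obj \<C>. \<exists>I. injective I \<and> (\<exists>x \<in> Hom A I. inflation x))"

definition WIC :: bool
  where "WIC \<longleftrightarrow> (\<forall>X Y Z f g. f \<in> Hom X Y \<and> g \<in> Hom Y Z \<longrightarrow>
    (inflation (g \<cdot> f) \<longrightarrow> inflation f) \<and> (deflation (g \<cdot> f) \<longrightarrow> deflation g))"

definition compatible :: "'m \<Rightarrow> bool"
  where "compatible f \<longleftrightarrow> (inflation f \<and> deflation f \<longrightarrow> iso_arrow \<C> f)"

definition right_exact_triangle :: "'o \<Rightarrow> 'm \<Rightarrow> 'o \<Rightarrow> 'm \<Rightarrow> 'o \<Rightarrow> bool"
  where "right_exact_triangle A x B y C \<longleftrightarrow> (\<exists>K h2. conflation K h2 B y C \<and>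
    (\<exists>h1 \<in> Hom A K. deflation h1 \<and> compatible h1 \<and> x = h2 \<cdot> h1))"

definition Defl :: "'o set \<Rightarrow> 'o set"
  where "Defl \<U> = {F \<in> Obj \<C>. \<exists>U \<in> \<U>. \<exists>y \<in> Hom U F. deflation y}"

definition closed_under_deflations :: "'o set \<Rightarrow> bool"
  where "closed_under_deflations \<U> \<longleftrightarrow> Defl \<U> = \<U>"

definition closed_under_extensions :: "'o set \<Rightarrow> bool"
  where "closed_under_extensions \<U> \<longleftrightarrow>
    (\<forall>A x B y C. conflation A x B y C \<and> A \<in> \<U> \<and> C \<in> \<U> \<longrightarrow> B \<in> \<U>)"

definition torsion_class :: "'o set \<Rightarrow> bool"
  where "torsion_class \<U> \<longleftrightarrow>
    subcategory \<C> \<U> \<and> closed_under_extensions \<U> \<and> closed_under_deflations \<U>"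

definition left_perp :: "'o set \<Rightarrow> 'o set"
  where "left_perp \<V> = {X \<in> Obj \<C>. \<forall>V \<in> \<V>. carrier (Ext \<C> X V) = {\<one>\<^bsub>Ext \<C> X V\<^esub>}}"

definition Ext_vanishes :: "'o set \<Rightarrow> 'o set \<Rightarrow> bool"
  where "Ext_vanishes \<U> \<V> \<longleftrightarrow> (\<forall>U \<in> \<U>. \<forall>V \<in> \<V>. carrier (Ext \<C> U V) = {\<one>\<^bsub>Ext \<C> U V\<^esub>})"

definition generator :: "'o set \<Rightarrow> 'o set \<Rightarrow> bool"
  where "generator \<U> \<V> \<longleftrightarrow> \<U> \<subseteq> \<V> \<and>
    (\<forall>V \<in> \<V>. \<exists>V' \<in> \<V>. \<exists>U \<in> \<U>. \<exists>x y. conflation V' x U y V)"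

text \<open>
  A projective resolution is recorded by its projectives \<open>P\<close> and its syzygies \<open>K\<close>, starting at
  \<open>K 0 = A\<close>. It has length at most \<open>n\<close> if it stops with \<open>P n \<cong> K n\<close>, that is, if the later
  syzygies are zero. It does not suffice that the later \<open>P i\<close> are zero: in a triangulated category
  \<open>K \<rightarrow> 0 \<rightarrow> K[1]\<close> is a conflation.
\<close>

definition projective_resolution :: "'o \<Rightarrow> (nat \<Rightarrow> 'o) \<Rightarrow> (nat \<Rightarrow> 'o) \<Rightarrow> bool"
  where "projective_resolution A P K \<longleftrightarrow> K 0 = A \<and>
    (\<forall>i. projective (P i) \<and> (\<exists>x y. conflation (K (Suc i)) x (P i) y (K i)))"

definition resolution_length :: "(nat \<Rightarrow> 'o) \<Rightarrow> enat"
  where "resolution_length K = Inf {enat n |n. \<forall>i>n. zero_object \<C> (K i)}"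

definition pd :: "'o \<Rightarrow> enat"
  where "pd A = Inf {resolution_length K |P K. projective_resolution A P K}"

definition pd_subcategory :: "'o set \<Rightarrow> enat"
  where "pd_subcategory \<T> = (SUP T \<in> \<T>. pd T)"

definition tilting :: "'o set \<Rightarrow> bool"
  where "tilting \<T> \<longleftrightarrow>
    subcategory \<C> \<T> \<and> closed_under_summands \<C> \<T> \<and> closed_under_finite_sums \<C> \<T> \<and>
    pd_subcategory \<T> \<le> 1 \<and>
    Ext_vanishes \<T> \<T> \<and>
    (\<forall>P. projective P \<longrightarrow> (\<exists>T0 \<in> \<T>. \<exists>T1 \<in> \<T>. \<exists>x y. conflation P x T0 y T1))"

definition support_tau_tilting :: "'o set \<Rightarrow> bool"
  where "support_tau_tilting \<T> \<longleftrightarrow>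
    subcategory \<C> \<T> \<and> closed_under_summands \<C> \<T> \<and> closed_under_finite_sums \<C> \<T> \<and>
    generator \<T> (Defl \<T>) \<and>
    Ext_vanishes \<T> (Defl \<T>) \<and>
    (\<forall>P. projective P \<longrightarrow> (\<exists>T0 \<in> \<T>. \<exists>T1 \<in> \<T>. \<exists>f g.
      right_exact_triangle P f T0 g T1 \<and> left_approximation \<C> \<T> P f T0))"

definition cotorsion_pair :: "'o set \<Rightarrow> 'o set \<Rightarrow> bool"
  where "cotorsion_pair \<U> \<V> \<longleftrightarrow>
    subcategory \<C> \<U> \<and> subcategory \<C> \<V> \<and>
    closed_under_summands \<C> \<U> \<and> closed_under_summands \<C> \<V> \<and>
    Ext_vanishes \<U> \<V> \<and>
    (\<forall>C \<in> Obj \<C>. \<exists>V \<in> \<V>. \<exists>U \<in> \<U>. \<exists>x y. conflation V x U y C) \<and>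
    (\<forall>C \<in> Obj \<C>. \<exists>V \<in> \<V>. \<exists>U \<in> \<U>. \<exists>x y. conflation C x V y U)"

definition tau_cotorsion_pair :: "'o set \<Rightarrow> 'o set \<Rightarrow> bool"
  where "tau_cotorsion_pair \<U> \<V> \<longleftrightarrow>
    subcategory \<C> \<U> \<and> subcategory \<C> \<V> \<and>
    \<U> = left_perp \<V> \<and>
    (\<forall>P. projective P \<longrightarrow> (\<exists>V \<in> \<U> \<inter> \<V>. \<exists>U \<in> \<U>. \<exists>f g.
      right_exact_triangle P f V g U \<and> left_approximation \<C> \<V> P f V))"

end

end

theory Submission
  imports Defs
begin

text \<open>
  For a tilting subcategory \<open>\<T>\<close>, projective dimension at most one makes \<open>\<bbbE>(T, -)\<close> right
  exact, so \<open>\<bbbE>(\<T>, \<T>) = 0\<close> spreads from \<open>\<T>\<close> to its quotients \<open>Defl \<C> \<T>\<close> (\<open>tilting_trivial_Ext_Defl\<close>). Transporting the coresolutions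
  \<open>P \<rightarrow> T\<^sub>0 \<rightarrow> T\<^sub>1\<close> of projectives along a deflation \<open>P \<rightarrow> C\<close> gives every object a coresolution
  \<open>C \<rightarrow> E \<rightarrow> T\<^sub>1\<close> with \<open>E\<close> in \<open>Defl \<C> \<T>\<close> and \<open>T\<^sub>1\<close> in \<open>\<T>\<close> (\<open>tilting_Defl_coresolution\<close>). This is
  one half of the cotorsion pair with right hand side \<open>Defl \<C> \<T>\<close>, and it gives the rest:

  \<^item> it splits when \<open>\<bbbE>(\<T>, C) = 0\<close>, so \<open>Defl \<C> \<T>\<close> is the right perpendicular subcategory of \<open>\<T>\<close>
    (\<open>tilting_Defl_eq\<close>) and hence closed under extensions;
  \<^item> glued to a conflation \<open>M \<rightarrow> T \<rightarrow> V\<close>, it makes \<open>\<T>\<close> a generator of \<open>Defl \<C> \<T>\<close>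
    (\<open>tilting_generator\<close>), so that \<open>\<T>\<close> is the intersection of \<open>Defl \<C> \<T>\<close> with its left
    perpendicular subcategory;
  \<^item> glued to a conflation \<open>K \<rightarrow> P \<rightarrow> C\<close>, it gives the other half of the cotorsion pair
    (\<open>tilting_imp_cotorsion_pair\<close>).

  The gluing is a pushout of two conflations with the same first term (\<open>conflation_pushout\<close>).

  Conversely let \<open>(\<U>, \<V>)\<close> be a cotorsion pair with \<open>\<V>\<close> a torsion class. Both subcategories are
  closed under extensions and \<open>\<U>\<close> contains the projectives, so the middle term of the conflation
  \<open>P \<rightarrow> V \<rightarrow> U\<close> of a projective \<open>P\<close>, and that of the conflation \<open>V' \<rightarrow> U \<rightarrow> V\<close> of an object \<open>V\<close> of
  \<open>\<V>\<close>, lie in \<open>\<U> \<inter> \<V>\<close>. The bound on the projective dimension is the one point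
  with a different argument (\<open>cotorsion_torsion_pd_le_one\<close>): \<open>\<V>\<close> contains the injectives and their
  quotients, so dimension shifting along \<open>X \<rightarrow> I \<rightarrow> Y\<close> reduces projectivity of the first syzygy of
  an object \<open>T\<close> of \<open>\<U>\<close> to the vanishing of \<open>\<bbbE>(T, Y)\<close> with \<open>Y \<in> \<V>\<close>.

  On either side, a conflation that coresolves a projective is a right exact triangle, and vanishing
  of the extensions of its last term makes its first arrow an approximation; so tilting
  subcategories are support tau-tilting, and cotorsion pairs are tau-cotorsion pairs.
\<close>

section \<open>Arrows, biproducts and zero objects\<close>

context category
begin

lemma Hom_src_in_Obj: "f \<in> Hom A B \<Longrightarrow> A \<in> Obj \<C>"
  and Hom_tgt_in_Obj: "f \<in> Hom A B \<Longrightarrow> B \<in> Obj \<C>"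
  using src_in_Obj tgt_in_Obj by (auto simp: Hom_def)

lemma iso_arrowI:
  assumes "f \<in> Hom A B" "g \<in> Hom B A" "g \<cdot> f = ident \<C> A" "f \<cdot> g = ident \<C> B"
  shows "iso_arrow \<C> f"
  using assms unfolding iso_arrow_def by (auto simp: Hom_def)

lemma iso_arrow_inverse:
  assumes "iso_arrow \<C> f" "f \<in> Hom A B"
  obtains g where "g \<in> Hom B A" "g \<cdot> f = ident \<C> A" "f \<cdot> g = ident \<C> B"
  using assms unfolding iso_arrow_def by (auto simp: Hom_def)

lemma subcategory_isomorphic:
  assumes "subcategory \<C> \<X>" "X \<in> \<X>" "isomorphic \<C> X Y"
  shows "Y \<in> \<X>"
  using assms Hom_tgt_in_Obj unfolding subcategory_def isomorphic_def by blast

lemma zero_object_Hom_unique: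
  assumes "zero_object \<C> Z" "f \<in> Hom A Z" "g \<in> Hom A Z"
  shows "f = g"
  using assms Hom_src_in_Obj unfolding zero_object_def by blast

lemma zero_object_Hom_unique':
  assumes "zero_object \<C> Z" "f \<in> Hom Z A" "g \<in> Hom Z A"
  shows "f = g"
  using assms Hom_tgt_in_Obj unfolding zero_object_def by blast

end

context additive_category
begin

lemma group_hom: "\<lbrakk>A \<in> Obj \<C>; B \<in> Obj \<C>\<rbrakk> \<Longrightarrow> group (hom_group \<C> A B)"
  using hom_comm_group comm_group.axioms(2) by blast

lemma hzero_in_Hom: "\<lbrakk>A \<in> Obj \<C>; B \<in> Obj \<C>\<rbrakk> \<Longrightarrow> hzero \<C> A B \<in> Hom A B"
  using group.is_monoid[OF group_hom] monoid.one_closed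
  by (fastforce simp: hom_group_def)

lemma hzero_hadd: "f \<in> Hom A B \<Longrightarrow> hzero \<C> A B \<boxplus> f = f"
  and hadd_commute: "\<lbrakk>f \<in> Hom A B; g \<in> Hom A B\<rbrakk> \<Longrightarrow> f \<boxplus> g = g \<boxplus> f"
proof -
  assume f: "f \<in> Hom A B"
  interpret G: comm_group "hom_group \<C> A B"
    using f hom_comm_group Hom_src_in_Obj Hom_tgt_in_Obj by blast
  show "hzero \<C> A B \<boxplus> f = f"
    using f G.l_one[of f] by (simp add: hom_group_def)
  show "f \<boxplus> g = g \<boxplus> f" if "g \<in> Hom A B"
    using f that G.m_comm[of f g] by (simp add: hom_group_def)
qed

lemma hadd_idem_hzero:
  assumes "z \<in> Hom A B" "z \<boxplus> z = z"
  shows "z = hzero \<C> A B"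
proof -
  interpret G: group "hom_group \<C> A B"
    using assms(1) group_hom Hom_src_in_Obj Hom_tgt_in_Obj by blast
  show ?thesis
    using G.r_cancel_one[of z z] assms by (simp add: hom_group_def)
qed

lemma comp_hzero:
  assumes "A \<in> Obj \<C>" "g \<in> Hom B C"
  shows "g \<cdot> hzero \<C> A B = hzero \<C> A C"
proof -
  have z: "hzero \<C> A B \<in> Hom A B"
    using assms Hom_src_in_Obj hzero_in_Hom by blast
  show ?thesis
    using hadd_idem_hzero[OF comp_in_Hom[OF z assms(2)]] comp_hadd_left[OF z z assms(2)]
      hzero_hadd[OF z] by simp
qed

lemma hzero_comp:
  assumes "C \<in> Obj \<C>" "f \<in> Hom A B"
  shows "hzero \<C> B C \<cdot> f = hzero \<C> A C"
proof -
  have z: "hzero \<C> B C \<in> Hom B C"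
    using assms Hom_tgt_in_Obj hzero_in_Hom by blast
  show ?thesis
    using hadd_idem_hzero[OF comp_in_Hom[OF assms(2) z]] comp_hadd_right[OF assms(2) z z]
      hzero_hadd[OF z] by simp
qed

lemma zero_object_ident: "zero_object \<C> Z \<Longrightarrow> ident \<C> Z = hzero \<C> Z Z"
  by (meson hzero_in_Hom ident_in_Hom zero_object_Hom_unique zero_object_def)

lemma biproduct_commute: "biproduct \<C> A B S i j p q \<Longrightarrow> biproduct \<C> B A S j i q p"
  unfolding biproduct_def by (metis comp_in_Hom hadd_commute)

lemma biproduct_iso:
  assumes S: "biproduct \<C> A B S i j p q" and b: "b \<in> Hom M S" "b' \<in> Hom S M"
    "b' \<cdot> b = ident \<C> M" "b \<cdot> b' = ident \<C> S"
  shows "biproduct \<C> A B M (b' \<cdot> i) (b' \<cdot> j) (p \<cdot> b) (q \<cdot> b)"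
proof -
  have ip: "i \<in> Hom A S" "j \<in> Hom B S" "p \<in> Hom S A" "q \<in> Hom S B"
    and ids: "p \<cdot> i = ident \<C> A" "q \<cdot> j = ident \<C> B" "p \<cdot> j = hzero \<C> B A" "q \<cdot> i = hzero \<C> A B"
      "(i \<cdot> p) \<boxplus> (j \<cdot> q) = ident \<C> S" and obj: "A \<in> Obj \<C>" "B \<in> Obj \<C>"
    using S unfolding biproduct_def by auto
  have cancel: "(r \<cdot> b) \<cdot> (b' \<cdot> k) = r \<cdot> k" if "r \<in> Hom S X" "k \<in> Hom Y S" for r k X Y
  proof -
    have "(r \<cdot> b) \<cdot> (b' \<cdot> k) = r \<cdot> (b \<cdot> (b' \<cdot> k))"
      using comp_assoc comp_in_Hom b that by blast
    also have "b \<cdot> (b' \<cdot> k) = k"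
      using comp_assoc[OF that(2) b(2,1)] b(4) ident_comp[OF that(2)] by simp
    finally show ?thesis .
  qed
  have conj: "(b' \<cdot> k) \<cdot> (r \<cdot> b) = b' \<cdot> (k \<cdot> r) \<cdot> b" if r: "r \<in> Hom S X" and k: "k \<in> Hom X S" for r k X
    using comp_assoc[OF b(1) r comp_in_Hom[OF k b(2)]] comp_assoc[OF r k b(2)] by simp
  have e: "i \<cdot> p \<in> Hom S S" "j \<cdot> q \<in> Hom S S"
    using comp_in_Hom ip by blast+
  have "((b' \<cdot> i) \<cdot> (p \<cdot> b)) \<boxplus> ((b' \<cdot> j) \<cdot> (q \<cdot> b)) = b' \<cdot> (i \<cdot> p) \<cdot> b \<boxplus> b' \<cdot> (j \<cdot> q) \<cdot> b"
    using conj ip by simp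
  also have "\<dots> = b' \<cdot> ((i \<cdot> p) \<boxplus> (j \<cdot> q)) \<cdot> b"
    using comp_hadd_left[OF e b(2)] comp_hadd_right[OF b(1) e[THEN comp_in_Hom[OF _ b(2)]]] by simp
  also have "\<dots> = ident \<C> M"
    using ids(5) comp_ident[OF b(2)] b(3) by simp
  finally have "((b' \<cdot> i) \<cdot> (p \<cdot> b)) \<boxplus> ((b' \<cdot> j) \<cdot> (q \<cdot> b)) = ident \<C> M" .
  then show ?thesis
    unfolding biproduct_def
    using cancel[OF ip(3,1)] cancel[OF ip(3,2)] cancel[OF ip(4,1)] cancel[OF ip(4,2)] ids obj
      comp_in_Hom[OF ip(1) b(2)] comp_in_Hom[OF ip(2) b(2)] comp_in_Hom[OF b(1) ip(3)]
      comp_in_Hom[OF b(1) ip(4)] Hom_src_in_Obj[OF b(1)] by simp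
qed

text \<open>
  Any isomorphism serves as the second inclusion, not only an identity: through the realization of
  the zero extension this is what makes isomorphisms deflations.
\<close>

lemma biproduct_zero_left:
  assumes Z: "zero_object \<C> Z" and f: "f \<in> Hom A B" "g \<in> Hom B A"
    "g \<cdot> f = ident \<C> A" "f \<cdot> g = ident \<C> B"
  shows "biproduct \<C> Z A B (hzero \<C> Z B) f (hzero \<C> B Z) g"
proof -
  have o: "Z \<in> Obj \<C>" "A \<in> Obj \<C>" "B \<in> Obj \<C>"
    using assms Hom_src_in_Obj Hom_tgt_in_Obj unfolding zero_object_def by blast+
  have "hzero \<C> B Z \<cdot> hzero \<C> Z B = ident \<C> Z"
    using comp_hzero[OF o(1) hzero_in_Hom[OF o(3,1)]] zero_object_ident[OF Z] by simp
  moreover have "(hzero \<C> Z B \<cdot> hzero \<C> B Z) \<boxplus> (f \<cdot> g) = ident \<C> B"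
    using comp_hzero[OF o(3) hzero_in_Hom[OF o(1,3)]] hzero_hadd[OF ident_in_Hom[OF o(3)]] f(4)
    by simp
  moreover have "hzero \<C> B Z \<cdot> f = hzero \<C> A Z" "g \<cdot> hzero \<C> Z B = hzero \<C> Z A"
    using o f(1,2) hzero_comp comp_hzero by blast+
  ultimately show ?thesis
    using o f hzero_in_Hom unfolding biproduct_def by blast
qed

lemma biproduct_zero_right:
  assumes "zero_object \<C> Z" "A \<in> Obj \<C>"
  shows "biproduct \<C> A Z A (ident \<C> A) (hzero \<C> Z A) (ident \<C> A) (hzero \<C> A Z)"
  using biproduct_zero_left[OF assms(1)] assms(2) ident_in_Hom comp_ident biproduct_commute by blast

end

section \<open>Extensions and their realizations\<close>

context extriangulated_category
begin

abbreviation trivial_Ext :: "'o \<Rightarrow> 'o \<Rightarrow> bool"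
  where "trivial_Ext C A \<equiv> carrier (Ext \<C> C A) = {\<one>\<^bsub>Ext \<C> C A\<^esub>}"

lemma group_Ext: "\<lbrakk>C \<in> Obj \<C>; A \<in> Obj \<C>\<rbrakk> \<Longrightarrow> group (Ext \<C> C A)"
  using Ext_comm_group comm_group.axioms(2) by blast

lemma one_in_Ext: "\<lbrakk>C \<in> Obj \<C>; A \<in> Obj \<C>\<rbrakk> \<Longrightarrow> \<one>\<^bsub>Ext \<C> C A\<^esub> \<in> carrier (Ext \<C> C A)"
  using group.is_monoid[OF group_Ext] monoid.one_closed by blast

lemma trivial_ExtI:
  assumes "C \<in> Obj \<C>" "A \<in> Obj \<C>"
    and "\<And>\<delta>. \<delta> \<in> carrier (Ext \<C> C A) \<Longrightarrow> \<delta> = \<one>\<^bsub>Ext \<C> C A\<^esub>"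
  shows "trivial_Ext C A"
  using assms one_in_Ext by blast

lemma realizes_objs:
  assumes "realizes \<C> \<delta> A x B y C"
  shows "A \<in> Obj \<C>" "B \<in> Obj \<C>" "C \<in> Obj \<C>" "\<delta> \<in> carrier (Ext \<C> C A)" "x \<in> Hom A B" "y \<in> Hom B C"
  using assms Hom_tgt_in_Obj unfolding realizes_def by blast+

lemma push_hom:
  assumes "C \<in> Obj \<C>" "a \<in> Hom A A'"
  shows "push \<C> C a \<in> hom (Ext \<C> C A) (Ext \<C> C A')"
  using Emap_hom[OF ident_in_Hom] assms unfolding push_def[abs_def] by (simp add: eta_contract_eq)

lemma pull_hom:
  assumes "A \<in> Obj \<C>" "c \<in> Hom C' C"
  shows "pull \<C> A c \<in> hom (Ext \<C> C A) (Ext \<C> C' A)"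
  using Emap_hom[OF _ ident_in_Hom] assms unfolding pull_def[abs_def] by (simp add: eta_contract_eq)

lemma push_closed:
  "\<lbrakk>C \<in> Obj \<C>; a \<in> Hom A A'; \<delta> \<in> carrier (Ext \<C> C A)\<rbrakk> \<Longrightarrow> push \<C> C a \<delta> \<in> carrier (Ext \<C> C A')"
  using push_hom unfolding hom_def by blast

lemma pull_closed:
  "\<lbrakk>A \<in> Obj \<C>; c \<in> Hom C' C; \<delta> \<in> carrier (Ext \<C> C A)\<rbrakk> \<Longrightarrow> pull \<C> A c \<delta> \<in> carrier (Ext \<C> C' A)"
  using pull_hom unfolding hom_def by blast

lemma push_one:
  assumes "C \<in> Obj \<C>" "a \<in> Hom A A'"
  shows "push \<C> C a \<one>\<^bsub>Ext \<C> C A\<^esub> = \<one>\<^bsub>Ext \<C> C A'\<^esub>"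
  using hom_one[OF push_hom[OF assms]] group_Ext assms Hom_src_in_Obj Hom_tgt_in_Obj by blast

lemma pull_one:
  assumes "A \<in> Obj \<C>" "c \<in> Hom C' C"
  shows "pull \<C> A c \<one>\<^bsub>Ext \<C> C A\<^esub> = \<one>\<^bsub>Ext \<C> C' A\<^esub>"
  using hom_one[OF pull_hom[OF assms]] group_Ext assms Hom_src_in_Obj Hom_tgt_in_Obj by blast

lemma push_ident:
  "\<lbrakk>C \<in> Obj \<C>; A \<in> Obj \<C>; \<delta> \<in> carrier (Ext \<C> C A)\<rbrakk> \<Longrightarrow> push \<C> C (ident \<C> A) \<delta> = \<delta>"
  unfolding push_def by (rule Emap_ident)

lemma pull_ident:
  "\<lbrakk>C \<in> Obj \<C>; A \<in> Obj \<C>; \<delta> \<in> carrier (Ext \<C> C A)\<rbrakk> \<Longrightarrow> pull \<C> A (ident \<C> C) \<delta> = \<delta>"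
  unfolding pull_def by (rule Emap_ident)

lemma push_push:
  assumes "C \<in> Obj \<C>" "a \<in> Hom A A'" "a' \<in> Hom A' A''" "\<delta> \<in> carrier (Ext \<C> C A)"
  shows "push \<C> C a' (push \<C> C a \<delta>) = push \<C> C (a' \<cdot> a) \<delta>"
  using Emap_comp[OF ident_in_Hom ident_in_Hom assms(2-4)] comp_ident[OF ident_in_Hom] assms(1)
  unfolding push_def by simp

lemma pull_pull:
  assumes "A \<in> Obj \<C>" "c \<in> Hom C' C" "c' \<in> Hom C'' C'" "\<delta> \<in> carrier (Ext \<C> C A)"
  shows "pull \<C> A c' (pull \<C> A c \<delta>) = pull \<C> A (c \<cdot> c') \<delta>"
  using Emap_comp[OF assms(2,3) ident_in_Hom ident_in_Hom assms(4)] comp_ident[OF ident_in_Hom]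
    assms(1)
  unfolding pull_def by simp

lemma push_pull:
  assumes "c \<in> Hom C' C" "a \<in> Hom A A'" "\<delta> \<in> carrier (Ext \<C> C A)"
  shows "push \<C> C' a (pull \<C> A c \<delta>) = pull \<C> A' c (push \<C> C a \<delta>)"
proof -
  have o: "A \<in> Obj \<C>" "A' \<in> Obj \<C>" "C \<in> Obj \<C>" "C' \<in> Obj \<C>"
    using assms Hom_src_in_Obj Hom_tgt_in_Obj by blast+
  note i = this[THEN ident_in_Hom]
  have "push \<C> C' a (pull \<C> A c \<delta>) = Emap \<C> (c \<cdot> ident \<C> C') (a \<cdot> ident \<C> A) \<delta>"
    unfolding push_def pull_def using Emap_comp[OF assms(1) i(4) i(1) assms(2,3)] by simp
  also have "\<dots> = Emap \<C> (ident \<C> C \<cdot> c) (ident \<C> A' \<cdot> a) \<delta>"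
    using assms(1,2) comp_ident ident_comp by simp
  also have "\<dots> = pull \<C> A' c (push \<C> C a \<delta>)"
    unfolding push_def pull_def using Emap_comp[OF i(3) assms(1,2) i(2) assms(3)] by simp
  finally show ?thesis .
qed

lemma pull_hzero:
  assumes "A \<in> Obj \<C>" "C \<in> Obj \<C>" "C' \<in> Obj \<C>" "\<delta> \<in> carrier (Ext \<C> C A)"
  shows "pull \<C> A (hzero \<C> C' C) \<delta> = \<one>\<^bsub>Ext \<C> C' A\<^esub>"
proof -
  have z: "hzero \<C> C' C \<in> Hom C' C"
    using assms hzero_in_Hom by blast
  interpret G: group "Ext \<C> C' A"
    using assms group_Ext by blast
  show ?thesis
    using pull_hadd[OF z z assms(1,4)] hzero_hadd[OF z] pull_closed[OF assms(1) z assms(4)]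
      G.r_cancel_one[of "pull \<C> A (hzero \<C> C' C) \<delta>" "pull \<C> A (hzero \<C> C' C) \<delta>"] by simp
qed

lemma push_hzero:
  assumes "C \<in> Obj \<C>" "A \<in> Obj \<C>" "A' \<in> Obj \<C>" "\<delta> \<in> carrier (Ext \<C> C A)"
  shows "push \<C> C (hzero \<C> A A') \<delta> = \<one>\<^bsub>Ext \<C> C A'\<^esub>"
proof -
  have z: "hzero \<C> A A' \<in> Hom A A'"
    using assms hzero_in_Hom by blast
  interpret G: group "Ext \<C> C A'"
    using assms group_Ext by blast
  show ?thesis
    using push_hadd[OF z z assms(1,4)] hzero_hadd[OF z] push_closed[OF assms(1) z assms(4)]
      G.r_cancel_one[of "push \<C> C (hzero \<C> A A') \<delta>" "push \<C> C (hzero \<C> A A') \<delta>"] by simp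
qed

lemma trivial_Ext_zero_left:
  assumes "zero_object \<C> Z" "A \<in> Obj \<C>"
  shows "trivial_Ext Z A"
proof (rule trivial_ExtI)
  show Z: "Z \<in> Obj \<C>"
    using assms(1) unfolding zero_object_def by simp
  show "\<delta> = \<one>\<^bsub>Ext \<C> Z A\<^esub>" if "\<delta> \<in> carrier (Ext \<C> Z A)" for \<delta>
    using pull_hzero[OF assms(2) Z Z that] pull_ident[OF Z assms(2) that]
      zero_object_ident[OF assms(1)] by simp
qed (rule assms(2))

lemma realization_exists:
  assumes "C \<in> Obj \<C>" "A \<in> Obj \<C>" "\<delta> \<in> carrier (Ext \<C> C A)"
  obtains x B y where "realizes \<C> \<delta> A x B y C"
proof -
  obtain x y where xy: "(x, y) \<in> sequences \<C> A C"
    "realization \<C> C A \<delta> = seq_equiv \<C> A C `` {(x, y)}"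
    using realization_class[OF assms] by (auto simp: quotient_def)
  obtain B where B: "x \<in> Hom A B" "y \<in> Hom B C"
    using xy(1) unfolding sequences_def by auto
  then have i: "ident \<C> B \<in> Hom B B"
    using Hom_tgt_in_Obj ident_in_Hom by blast
  then have "iso_arrow \<C> (ident \<C> B)"
    using comp_ident iso_arrowI by blast
  moreover have "tgt \<C> x = B"
    using B(1) unfolding Hom_def by simp
  ultimately have "(x, y) \<in> realization \<C> C A \<delta>"
    using xy B i comp_ident ident_comp unfolding seq_equiv_def by auto
  then show thesis
    using that assms B unfolding realizes_def by blast
qed

lemma realization_unique:
  assumes "realizes \<C> \<delta> A x B y C" "realizes \<C> \<delta> A x' B' y' C"
  obtains b where "b \<in> Hom B B'" "iso_arrow \<C> b" "b \<cdot> x = x'" "y' \<cdot> b = y"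
proof -
  obtain u v where uv: "(u, v) \<in> sequences \<C> A C"
    "realization \<C> C A \<delta> = seq_equiv \<C> A C `` {(u, v)}"
    using realization_class[OF realizes_objs(3,1,4)[OF assms(1)]] by (auto simp: quotient_def)
  obtain D where D: "u \<in> Hom A D" "v \<in> Hom D C"
    using uv(1) unfolding sequences_def by auto
  have t: "tgt \<C> x = B" "tgt \<C> x' = B'" "tgt \<C> u = D"
    using realizes_objs(5)[OF assms(1)] realizes_objs(5)[OF assms(2)] D unfolding Hom_def by auto
  have "((u, v), (x, y)) \<in> seq_equiv \<C> A C" "((u, v), (x', y')) \<in> seq_equiv \<C> A C"
    using assms uv(2) unfolding realizes_def by auto
  then obtain c d where c: "c \<in> Hom D B" "iso_arrow \<C> c" "c \<cdot> u = x" "y \<cdot> c = v"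
    and d: "d \<in> Hom D B'" "iso_arrow \<C> d" "d \<cdot> u = x'" "y' \<cdot> d = v"
    unfolding seq_equiv_def using t by auto
  obtain c' where c': "c' \<in> Hom B D" "c' \<cdot> c = ident \<C> D" "c \<cdot> c' = ident \<C> B"
    using iso_arrow_inverse[OF c(2,1)] .
  obtain d' where d': "d' \<in> Hom B' D" "d' \<cdot> d = ident \<C> D" "d \<cdot> d' = ident \<C> B'"
    using iso_arrow_inverse[OF d(2,1)] .
  have h: "d \<cdot> c' \<in> Hom B B'" "c \<cdot> d' \<in> Hom B' B"
    using comp_in_Hom c d c' d' by blast+
  have "(c \<cdot> d') \<cdot> (d \<cdot> c') = c \<cdot> (d' \<cdot> (d \<cdot> c'))"
    using comp_assoc[OF h(1) d'(1) c(1)] .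
  also have "d' \<cdot> (d \<cdot> c') = c'"
    using comp_assoc[OF c'(1) d(1) d'(1)] d'(2) ident_comp[OF c'(1)] by simp
  finally have 1: "(c \<cdot> d') \<cdot> (d \<cdot> c') = ident \<C> B"
    using c'(3) by simp
  have "(d \<cdot> c') \<cdot> (c \<cdot> d') = d \<cdot> (c' \<cdot> (c \<cdot> d'))"
    using comp_assoc[OF h(2) c'(1) d(1)] .
  also have "c' \<cdot> (c \<cdot> d') = d'"
    using comp_assoc[OF d'(1) c(1) c'(1)] c'(2) ident_comp[OF d'(1)] by simp
  finally have 2: "(d \<cdot> c') \<cdot> (c \<cdot> d') = ident \<C> B'"
    using d'(3) by simp
  have "(d \<cdot> c') \<cdot> x = d \<cdot> (c' \<cdot> x)"
    using comp_assoc[OF realizes_objs(5)[OF assms(1)] c'(1) d(1)] .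
  also have "c' \<cdot> x = u"
    using comp_assoc[OF D(1) c(1) c'(1)] c(3) c'(2) ident_comp[OF D(1)] by simp
  finally have 3: "(d \<cdot> c') \<cdot> x = x'"
    using d(3) by simp
  have "y' \<cdot> (d \<cdot> c') = v \<cdot> c'"
    using comp_assoc[OF c'(1) d(1) realizes_objs(6)[OF assms(2)]] d(4) by simp
  also have "\<dots> = y"
    using comp_assoc[OF c'(1) c(1) realizes_objs(6)[OF assms(1)]] c(4) c'(3)
      comp_ident[OF realizes_objs(6)[OF assms(1)]] by simp
  finally show thesis
    using that h(1) iso_arrowI[OF h 1 2] 3 by blast
qed

text \<open>
  The only extension of \<open>C\<close> by \<open>A\<close> is the zero one, whose realization is the class of the canonical
  biproduct sequence; the biproduct structure is carried over along the equivalence.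
\<close>

lemma split_conflation_biproduct:
  assumes "conflation \<C> A x B y C" "trivial_Ext C A"
  obtains j p where "biproduct \<C> A C B x j p y"
proof -
  have r: "realizes \<C> \<one>\<^bsub>Ext \<C> C A\<^esub> A x B y C"
    using assms unfolding conflation_def by (metis realizes_objs(4) singletonD)
  obtain S i j p q where S: "biproduct \<C> A C S i j p q"
    using biproduct_exists realizes_objs(1,3)[OF r] by blast
  obtain b where b: "b \<in> Hom B S" "iso_arrow \<C> b" "b \<cdot> x = i" "q \<cdot> b = y"
    using realization_unique[OF r realization_zero[OF S]] .
  obtain b' where b': "b' \<in> Hom S B" "b' \<cdot> b = ident \<C> B" "b \<cdot> b' = ident \<C> S"
    using iso_arrow_inverse[OF b(2,1)] .
  have "b' \<cdot> i = x"
    using comp_assoc[OF realizes_objs(5)[OF r] b(1) b'(1)] b(3) b'(2)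
      ident_comp[OF realizes_objs(5)[OF r]] by simp
  then have "biproduct \<C> A C B x (b' \<cdot> j) (p \<cdot> b) y"
    using biproduct_iso[OF S b(1) b'] b(4) by simp
  then show thesis by (rule that)
qed

section \<open>The long exact sequences\<close>

text \<open>
  Exactness of \<open>Hom(W, B) \<rightarrow> Hom(W, C) \<rightarrow> \<bbbE>(W, A)\<close>. If \<open>f\<^sup>*\<theta> = 0\<close>, then \<open>(1, f)\<close> is a morphism from
  the zero extension to \<open>\<theta>\<close>; its realization is an arrow \<open>A \<oplus> W \<rightarrow> B\<close>, and the lift is its
  restriction to \<open>W\<close>. The next lemma is the dual.
\<close>

lemma lift_along_deflation:
  assumes r: "realizes \<C> \<theta> A x B y C" and f: "f \<in> Hom W C" "pull \<C> A f \<theta> = \<one>\<^bsub>Ext \<C> W A\<^esub>"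
  obtains g where "g \<in> Hom W B" "y \<cdot> g = f"
proof -
  note o = realizes_objs[OF r]
  have W: "W \<in> Obj \<C>" using f Hom_src_in_Obj by blast
  obtain S i j p q where S: "biproduct \<C> A W S i j p q"
    using biproduct_exists[OF o(1) W] by blast
  then have j: "j \<in> Hom W S" "q \<in> Hom S W" "q \<cdot> j = ident \<C> W"
    unfolding biproduct_def by auto
  have "ext_morphism \<C> W A \<one>\<^bsub>Ext \<C> W A\<^esub> C A \<theta> (ident \<C> A) f"
    unfolding ext_morphism_def using f push_one[OF W] ident_in_Hom[OF o(1)] by simp
  then obtain b where b: "b \<in> Hom S B" "y \<cdot> b = f \<cdot> q"
    using realization_morphism[OF realization_zero[OF S] r] by blast
  have "y \<cdot> (b \<cdot> j) = f \<cdot> (q \<cdot> j)"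
    using comp_assoc[OF j(1) b(1) o(6)] comp_assoc[OF j(1,2) f(1)] b(2) by simp
  then have "y \<cdot> (b \<cdot> j) = f"
    using j(3) comp_ident[OF f(1)] by simp
  then show thesis using that comp_in_Hom[OF j(1) b(1)] by blast
qed

lemma extend_along_inflation:
  assumes r: "realizes \<C> \<theta> A x B y C" and f: "f \<in> Hom A W" "push \<C> C f \<theta> = \<one>\<^bsub>Ext \<C> C W\<^esub>"
  obtains g where "g \<in> Hom B W" "g \<cdot> x = f"
proof -
  note o = realizes_objs[OF r]
  have W: "W \<in> Obj \<C>" using f Hom_tgt_in_Obj by blast
  obtain S i j p q where S: "biproduct \<C> W C S i j p q"
    using biproduct_exists[OF W o(3)] by blast
  then have p: "i \<in> Hom W S" "p \<in> Hom S W" "p \<cdot> i = ident \<C> W"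
    unfolding biproduct_def by auto
  have "ext_morphism \<C> C A \<theta> C W \<one>\<^bsub>Ext \<C> C W\<^esub> f (ident \<C> C)"
    unfolding ext_morphism_def using f pull_one[OF W] ident_in_Hom[OF o(3)] by simp
  then obtain b where b: "b \<in> Hom B S" "b \<cdot> x = i \<cdot> f"
    using realization_morphism[OF r realization_zero[OF S]] by blast
  have "(p \<cdot> b) \<cdot> x = (p \<cdot> i) \<cdot> f"
    using comp_assoc[OF o(5) b(1) p(2)] comp_assoc[OF f(1) p(1,2)] b(2) by simp
  then have "(p \<cdot> b) \<cdot> x = f"
    using p(3) ident_comp[OF f(1)] by simp
  then show thesis using that comp_in_Hom[OF b(1) p(2)] by blast
qed

text \<open>
  Exactness of \<open>Hom(A, X) \<rightarrow> \<bbbE>(C, X) \<rightarrow> \<bbbE>(B, X)\<close>. If \<open>y\<^sup>*\<delta> = 0\<close>, then \<open>y\<close> lifts to the middle term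
  of \<open>\<delta>\<close>, and completing this lift to a morphism of extensions gives \<open>f\<close>. The next lemma is the
  dual.
\<close>

lemma push_of_connecting:
  assumes r: "realizes \<C> \<theta> A x B y C" and \<delta>: "X \<in> Obj \<C>" "\<delta> \<in> carrier (Ext \<C> C X)"
    "pull \<C> X y \<delta> = \<one>\<^bsub>Ext \<C> B X\<^esub>"
  obtains f where "f \<in> Hom A X" "\<delta> = push \<C> C f \<theta>"
proof -
  note o = realizes_objs[OF r]
  obtain u E v where E: "realizes \<C> \<delta> X u E v C"
    using realization_exists[OF o(3) \<delta>(1,2)] .
  obtain b where b: "b \<in> Hom B E" "v \<cdot> b = y"
    using lift_along_deflation[OF E o(6) \<delta>(3)] .
  then obtain f where "ext_morphism \<C> C A \<theta> C X \<delta> f (ident \<C> C)"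
    using ET3_op[OF r E b(1) ident_in_Hom[OF o(3)]] ident_comp[OF o(6)] by auto
  then show thesis
    using that pull_ident[OF o(3) \<delta>(1,2)] unfolding ext_morphism_def by auto
qed

lemma pull_of_connecting:
  assumes r: "realizes \<C> \<theta> A x B y C" and \<delta>: "W \<in> Obj \<C>" "\<delta> \<in> carrier (Ext \<C> W A)"
    "push \<C> W x \<delta> = \<one>\<^bsub>Ext \<C> W B\<^esub>"
  obtains f where "f \<in> Hom W C" "\<delta> = pull \<C> A f \<theta>"
proof -
  note o = realizes_objs[OF r]
  obtain u E v where E: "realizes \<C> \<delta> A u E v W"
    using realization_exists[OF \<delta>(1) o(1) \<delta>(2)] .
  obtain b where b: "b \<in> Hom E B" "b \<cdot> u = x"
    using extend_along_inflation[OF E o(5) \<delta>(3)] .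
  then obtain f where "ext_morphism \<C> W A \<delta> C A \<theta> (ident \<C> A) f"
    using ET3[OF E r ident_in_Hom[OF o(1)] b(1)] comp_ident[OF o(5)] by auto
  then show thesis
    using that push_ident[OF \<delta>(1) o(1) \<delta>(2)] unfolding ext_morphism_def by auto
qed

text \<open>
  Exactness of \<open>\<bbbE>(C, X) \<rightarrow> \<bbbE>(B, X) \<rightarrow> \<bbbE>(A, X)\<close>. The octahedron on the deflations \<open>E \<rightarrow> B \<rightarrow> C\<close> yields
  an extension \<open>\<eta>\<close> of \<open>C\<close> by the middle term \<open>E\<^sub>0\<close> of \<open>x\<^sup>*\<delta>\<close> with \<open>y\<^sup>*\<eta> = e\<^sub>*\<delta>\<close>. If \<open>x\<^sup>*\<delta> = 0\<close>, then
  \<open>e : X \<rightarrow> E\<^sub>0\<close> has a retraction \<open>s\<close>, and \<open>\<delta> = s\<^sub>* e\<^sub>*\<delta> = y\<^sup>* s\<^sub>*\<eta>\<close>. The next lemma is the dual.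
\<close>

lemma pull_exact_middle:
  assumes r: "realizes \<C> \<theta> A x B y C" and \<delta>: "X \<in> Obj \<C>" "\<delta> \<in> carrier (Ext \<C> B X)"
    "pull \<C> X x \<delta> = \<one>\<^bsub>Ext \<C> A X\<^esub>"
  obtains \<epsilon> where "\<epsilon> \<in> carrier (Ext \<C> C X)" "\<delta> = pull \<C> X y \<epsilon>"
proof -
  note o = realizes_objs[OF r]
  obtain u E v where E: "realizes \<C> \<delta> X u E v B"
    using realization_exists[OF o(2) \<delta>(1,2)] .
  obtain E\<^sub>0 h d e \<eta> where ET: "e \<in> Hom X E\<^sub>0" "realizes \<C> \<eta> E\<^sub>0 h E (y \<cdot> v) C"
    "realizes \<C> (pull \<C> X x \<delta>) X e E\<^sub>0 d A" "pull \<C> E\<^sub>0 y \<eta> = push \<C> B e \<delta>"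
    using ET4_op[OF r E] by blast
  have "push \<C> A (ident \<C> X) (pull \<C> X x \<delta>) = \<one>\<^bsub>Ext \<C> A X\<^esub>"
    using \<delta>(3) push_one[OF o(1) ident_in_Hom[OF \<delta>(1)]] by simp
  then obtain s where s: "s \<in> Hom E\<^sub>0 X" "s \<cdot> e = ident \<C> X"
    using extend_along_inflation[OF ET(3) ident_in_Hom[OF \<delta>(1)]] by blast
  note \<eta> = realizes_objs(4)[OF ET(2)]
  have "\<delta> = push \<C> B s (push \<C> B e \<delta>)"
    using push_push[OF o(2) ET(1) s(1) \<delta>(2)] s(2) push_ident[OF o(2) \<delta>(1,2)] by simp
  also have "\<dots> = pull \<C> X y (push \<C> C s \<eta>)"
    using ET(4) push_pull[OF o(6) s(1) \<eta>] by simp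
  finally show thesis
    using that push_closed[OF o(3) s(1) \<eta>] by blast
qed

lemma push_exact_middle:
  assumes r: "realizes \<C> \<theta> A x B y C" and \<delta>: "W \<in> Obj \<C>" "\<delta> \<in> carrier (Ext \<C> W B)"
    "push \<C> W y \<delta> = \<one>\<^bsub>Ext \<C> W C\<^esub>"
  obtains \<epsilon> where "\<epsilon> \<in> carrier (Ext \<C> W A)" "\<delta> = push \<C> W x \<epsilon>"
proof -
  note o = realizes_objs[OF r]
  obtain u E v where E: "realizes \<C> \<delta> B u E v W"
    using realization_exists[OF \<delta>(1) o(2) \<delta>(2)] .
  obtain E\<^sub>0 h d e \<eta> where ET: "e \<in> Hom E\<^sub>0 W" "realizes \<C> \<eta> A (u \<cdot> x) E h E\<^sub>0"
    "realizes \<C> (push \<C> W y \<delta>) C d E\<^sub>0 e W" "push \<C> E\<^sub>0 x \<eta> = pull \<C> B e \<delta>"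
    using ET4[OF r E] by blast
  have "pull \<C> C (ident \<C> W) (push \<C> W y \<delta>) = \<one>\<^bsub>Ext \<C> W C\<^esub>"
    using \<delta>(3) pull_one[OF o(3) ident_in_Hom[OF \<delta>(1)]] by simp
  then obtain s where s: "s \<in> Hom W E\<^sub>0" "e \<cdot> s = ident \<C> W"
    using lift_along_deflation[OF ET(3) ident_in_Hom[OF \<delta>(1)]] by blast
  note \<eta> = realizes_objs(4)[OF ET(2)]
  have "\<delta> = pull \<C> B s (pull \<C> B e \<delta>)"
    using pull_pull[OF o(2) ET(1) s(1) \<delta>(2)] s(2) pull_ident[OF \<delta>(1) o(2) \<delta>(2)] by simp
  also have "\<dots> = push \<C> W x (pull \<C> A s \<eta>)"
    using ET(4) push_pull[OF s(1) o(5) \<eta>] by simp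
  finally show thesis
    using that pull_closed[OF o(1) s(1) \<eta>] by blast
qed

section \<open>Inflations, deflations and conflations\<close>

lemma conflation_realizes:
  assumes "conflation \<C> A x B y C"
  obtains \<delta> where "realizes \<C> \<delta> A x B y C"
  using assms unfolding conflation_def by blast

lemma conflation_objs:
  assumes "conflation \<C> A x B y C"
  shows "A \<in> Obj \<C>" "B \<in> Obj \<C>" "C \<in> Obj \<C>" "x \<in> Hom A B" "y \<in> Hom B C"
  using conflation_realizes[OF assms] realizes_objs(1,2,3,5,6) by metis+

lemma conflation_deflation: "conflation \<C> A x B y C \<Longrightarrow> deflation \<C> y"
  unfolding deflation_def by blast

lemma deflation_conflation:
  assumes "deflation \<C> y" "y \<in> Hom B C"
  obtains A x where "conflation \<C> A x B y C"
proof -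
  obtain A x B' C' where y: "conflation \<C> A x B' y C'"
    using assms(1) unfolding deflation_def by blast
  then have "B' = B" "C' = C"
    using conflation_objs(5)[OF y] assms(2) unfolding Hom_def by auto
  then show thesis using that y by blast
qed

lemma inflation_conflation:
  assumes "inflation \<C> x" "x \<in> Hom A B"
  obtains y C where "conflation \<C> A x B y C"
proof -
  obtain A' B' y C where x: "conflation \<C> A' x B' y C"
    using assms(1) unfolding inflation_def by blast
  then have "A' = A" "B' = B"
    using conflation_objs(4)[OF x] assms(2) unfolding Hom_def by auto
  then show thesis using that x by blast
qed

lemma biproduct_conflation:
  "biproduct \<C> A C S i j p q \<Longrightarrow> conflation \<C> A i S q C"
  using realization_zero unfolding conflation_def by blast

lemma conflation_zero_ident:
  assumes "zero_object \<C> Z" "A \<in> Obj \<C>"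
  shows "conflation \<C> Z (hzero \<C> Z A) A (ident \<C> A) A"
  using biproduct_conflation biproduct_zero_left[OF assms(1)] assms(2) ident_in_Hom comp_ident
  by blast

lemma iso_deflation:
  assumes "iso_arrow \<C> f" "f \<in> Hom A B"
  shows "deflation \<C> f"
proof -
  obtain g where g: "g \<in> Hom B A" "g \<cdot> f = ident \<C> A" "f \<cdot> g = ident \<C> B"
    using iso_arrow_inverse[OF assms] .
  obtain Z where "zero_object \<C> Z"
    using zero_object_exists by blast
  then show ?thesis
    using biproduct_zero_left[OF _ g(1) assms(2) g(3,2)] biproduct_conflation conflation_deflation
    by blast
qed

lemma ident_iso: "A \<in> Obj \<C> \<Longrightarrow> iso_arrow \<C> (ident \<C> A)"
  using ident_in_Hom comp_ident iso_arrowI by blast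

lemma deflation_comp:
  assumes "deflation \<C> f" "f \<in> Hom A B" "deflation \<C> g" "g \<in> Hom B C"
  shows "deflation \<C> (g \<cdot> f)"
proof -
  obtain D k where "conflation \<C> D k B g C"
    using deflation_conflation[OF assms(3,4)] .
  then obtain \<delta> where \<delta>: "realizes \<C> \<delta> D k B g C"
    by (rule conflation_realizes)
  obtain F l where "conflation \<C> F l A f B"
    using deflation_conflation[OF assms(1,2)] .
  then obtain \<delta>' where \<delta>': "realizes \<C> \<delta>' F l A f B"
    by (rule conflation_realizes)
  show ?thesis
    using ET4_op[OF \<delta> \<delta>'] unfolding deflation_def conflation_def by blast
qed

text \<open>
  The deflation in the factorization is the identity of \<open>A\<close>.
\<close>

lemma conflation_right_exact:
  assumes "conflation \<C> A x B y C"
  shows "right_exact_triangle \<C> A x B y C"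
proof -
  note o = conflation_objs[OF assms]
  show ?thesis
    unfolding right_exact_triangle_def compatible_def
    using assms ident_in_Hom[OF o(1)] ident_iso[OF o(1)] iso_deflation comp_ident[OF o(4)] by metis
qed

lemma conflation_cobase_change:
  assumes "conflation \<C> A f B f' D" "conflation \<C> B g C g' F"
  obtains E h' d e where "conflation \<C> A (g \<cdot> f) C h' E" "conflation \<C> D d E e F"
proof -
  obtain \<delta> \<delta>' where "realizes \<C> \<delta> A f B f' D" "realizes \<C> \<delta>' B g C g' F"
    using assms conflation_realizes by metis
  from ET4[OF this] show thesis
    using that unfolding conflation_def by blast
qed

lemma pull_biproduct_inclusion:
  assumes S: "biproduct \<C> C\<^sub>1 C\<^sub>2 S i j p q" and A: "A \<in> Obj \<C>"
    and \<delta>: "\<delta> \<in> carrier (Ext \<C> C\<^sub>1 A)" "\<epsilon> \<in> carrier (Ext \<C> C\<^sub>2 A)"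
  shows "pull \<C> A i (pull \<C> A p \<delta> \<otimes>\<^bsub>Ext \<C> S A\<^esub> pull \<C> A q \<epsilon>) = \<delta>"
    and "pull \<C> A j (pull \<C> A p \<delta> \<otimes>\<^bsub>Ext \<C> S A\<^esub> pull \<C> A q \<epsilon>) = \<epsilon>"
proof -
  have h: "i \<in> Hom C\<^sub>1 S" "j \<in> Hom C\<^sub>2 S" "p \<in> Hom S C\<^sub>1" "q \<in> Hom S C\<^sub>2"
    and o: "C\<^sub>1 \<in> Obj \<C>" "C\<^sub>2 \<in> Obj \<C>"
    and c: "p \<cdot> i = ident \<C> C\<^sub>1" "q \<cdot> j = ident \<C> C\<^sub>2" "p \<cdot> j = hzero \<C> C\<^sub>2 C\<^sub>1" "q \<cdot> i = hzero \<C> C\<^sub>1 C\<^sub>2"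
    using S unfolding biproduct_def by auto
  interpret G1: group "Ext \<C> C\<^sub>1 A" using group_Ext o A by blast
  interpret G2: group "Ext \<C> C\<^sub>2 A" using group_Ext o A by blast
  note cl = pull_closed[OF A h(3) \<delta>(1)] pull_closed[OF A h(4) \<delta>(2)]
  have "pull \<C> A i (pull \<C> A p \<delta>) = \<delta>" "pull \<C> A i (pull \<C> A q \<epsilon>) = \<one>\<^bsub>Ext \<C> C\<^sub>1 A\<^esub>"
    "pull \<C> A j (pull \<C> A p \<delta>) = \<one>\<^bsub>Ext \<C> C\<^sub>2 A\<^esub>" "pull \<C> A j (pull \<C> A q \<epsilon>) = \<epsilon>"
    using pull_pull[OF A h(3,1) \<delta>(1)] pull_pull[OF A h(4,1) \<delta>(2)] pull_pull[OF A h(3,2) \<delta>(1)]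
      pull_pull[OF A h(4,2) \<delta>(2)] c pull_ident o A \<delta> pull_hzero by simp_all
  then show "pull \<C> A i (pull \<C> A p \<delta> \<otimes>\<^bsub>Ext \<C> S A\<^esub> pull \<C> A q \<epsilon>) = \<delta>"
    and "pull \<C> A j (pull \<C> A p \<delta> \<otimes>\<^bsub>Ext \<C> S A\<^esub> pull \<C> A q \<epsilon>) = \<epsilon>"
    using hom_mult[OF pull_hom[OF A h(1)] cl] hom_mult[OF pull_hom[OF A h(2)] cl] \<delta> by simp_all
qed

text \<open>
  The inclusion \<open>i\<close> and the projection \<open>q\<close> form a conflation \<open>C\<^sub>1 \<rightarrow> S \<rightarrow> C\<^sub>2\<close>. The octahedron on the
  deflations \<open>M \<rightarrow> S \<rightarrow> C\<^sub>2\<close> gives the kernel of their composite as the middle term of a realization of \<open>i\<^sup>*\<nu>\<close>, which is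
  unique only up to isomorphism.
\<close>

lemma conflation_of_pull_biproduct:
  assumes S: "biproduct \<C> C\<^sub>1 C\<^sub>2 S i j p q" and \<nu>: "realizes \<C> \<nu> A u M v S"
    and \<delta>: "realizes \<C> (pull \<C> A i \<nu>) A x B y C\<^sub>1"
  obtains E e h where "isomorphic \<C> B E" "conflation \<C> E e M h C\<^sub>2"
proof -
  obtain E h d e \<eta> where E: "realizes \<C> \<eta> E h M (q \<cdot> v) C\<^sub>2"
    "realizes \<C> (pull \<C> A i \<nu>) A e E d C\<^sub>1"
    using ET4_op[OF realization_zero[OF S] \<nu>] by blast
  obtain b where "b \<in> Hom B E" "iso_arrow \<C> b"
    using realization_unique[OF \<delta> E(2)] .
  then show thesis
    using that E(1) unfolding isomorphic_def conflation_def by blast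
qed

text \<open>
  The pushout \<open>M\<close> of two inflations \<open>A \<rightarrow> B\<^sub>1\<close> and \<open>A \<rightarrow> B\<^sub>2\<close> is the middle term of an extension of
  \<open>C\<^sub>1 \<oplus> C\<^sub>2\<close> by \<open>A\<close> that restricts to the two given extensions. The objects \<open>E\<^sub>1\<close> and \<open>E\<^sub>2\<close> absorb the
  choice of realizations.
\<close>

lemma conflation_pushout:
  assumes "conflation \<C> A x\<^sub>1 B\<^sub>1 y\<^sub>1 C\<^sub>1" "conflation \<C> A x\<^sub>2 B\<^sub>2 y\<^sub>2 C\<^sub>2"
  obtains M E\<^sub>1 E\<^sub>2 u\<^sub>1 v\<^sub>1 u\<^sub>2 v\<^sub>2 where "isomorphic \<C> B\<^sub>1 E\<^sub>1" "conflation \<C> E\<^sub>1 u\<^sub>1 M v\<^sub>1 C\<^sub>2"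
    "isomorphic \<C> B\<^sub>2 E\<^sub>2" "conflation \<C> E\<^sub>2 u\<^sub>2 M v\<^sub>2 C\<^sub>1"
proof -
  obtain \<delta> \<epsilon> where r: "realizes \<C> \<delta> A x\<^sub>1 B\<^sub>1 y\<^sub>1 C\<^sub>1" "realizes \<C> \<epsilon> A x\<^sub>2 B\<^sub>2 y\<^sub>2 C\<^sub>2"
    using assms conflation_realizes by metis
  note o = realizes_objs[OF r(1)] realizes_objs[OF r(2)]
  obtain S i j p q where S: "biproduct \<C> C\<^sub>1 C\<^sub>2 S i j p q"
    using biproduct_exists[OF o(3,9)] by blast
  then have h: "S \<in> Obj \<C>" "p \<in> Hom S C\<^sub>1" "q \<in> Hom S C\<^sub>2"
    unfolding biproduct_def by auto
  define \<nu> where "\<nu> = pull \<C> A p \<delta> \<otimes>\<^bsub>Ext \<C> S A\<^esub> pull \<C> A q \<epsilon>"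
  have \<nu>: "pull \<C> A i \<nu> = \<delta>" "pull \<C> A j \<nu> = \<epsilon>"
    unfolding \<nu>_def using pull_biproduct_inclusion[OF S o(1,4,10)] by simp_all
  interpret G: group "Ext \<C> S A" using group_Ext h(1) o(1) by blast
  have "\<nu> \<in> carrier (Ext \<C> S A)"
    unfolding \<nu>_def using pull_closed[OF o(1) h(2) o(4)] pull_closed[OF o(1) h(3) o(10)] by simp
  then obtain u M v where M: "realizes \<C> \<nu> A u M v S"
    using realization_exists[OF h(1) o(1)] by blast
  obtain E\<^sub>1 u\<^sub>1 v\<^sub>1 where "isomorphic \<C> B\<^sub>1 E\<^sub>1" "conflation \<C> E\<^sub>1 u\<^sub>1 M v\<^sub>1 C\<^sub>2"
    using conflation_of_pull_biproduct[OF S M] \<nu>(1) r(1) by blast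
  moreover obtain E\<^sub>2 u\<^sub>2 v\<^sub>2 where "isomorphic \<C> B\<^sub>2 E\<^sub>2" "conflation \<C> E\<^sub>2 u\<^sub>2 M v\<^sub>2 C\<^sub>1"
    using conflation_of_pull_biproduct[OF biproduct_commute[OF S] M] \<nu>(2) r(2) by blast
  ultimately show thesis by (rule that)
qed

section \<open>Vanishing of extensions\<close>

lemma trivial_ExtD: "\<lbrakk>trivial_Ext C A; \<delta> \<in> carrier (Ext \<C> C A)\<rbrakk> \<Longrightarrow> \<delta> = \<one>\<^bsub>Ext \<C> C A\<^esub>"
  by blast

lemma lift_if_trivial_Ext:
  assumes c: "conflation \<C> A x B y C" and t: "trivial_Ext W A" and f: "f \<in> Hom W C"
  obtains g where "g \<in> Hom W B" "y \<cdot> g = f"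
proof -
  obtain \<theta> where \<theta>: "realizes \<C> \<theta> A x B y C"
    using c by (rule conflation_realizes)
  have "pull \<C> A f \<theta> = \<one>\<^bsub>Ext \<C> W A\<^esub>"
    using trivial_ExtD[OF t pull_closed[OF realizes_objs(1)[OF \<theta>] f realizes_objs(4)[OF \<theta>]]] by simp
  then show thesis
    using lift_along_deflation[OF \<theta> f] that by blast
qed

lemma extend_if_trivial_Ext:
  assumes c: "conflation \<C> A x B y C" and t: "trivial_Ext C W" and f: "f \<in> Hom A W"
  obtains g where "g \<in> Hom B W" "g \<cdot> x = f"
proof -
  obtain \<theta> where \<theta>: "realizes \<C> \<theta> A x B y C"
    using c by (rule conflation_realizes)
  have "push \<C> C f \<theta> = \<one>\<^bsub>Ext \<C> C W\<^esub>"
    using trivial_ExtD[OF t push_closed[OF realizes_objs(3)[OF \<theta>] f realizes_objs(4)[OF \<theta>]]] by simp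
  then show thesis
    using extend_along_inflation[OF \<theta> f] that by blast
qed

lemma inflation_left_approximation:
  assumes c: "conflation \<C> A x B y C" and B: "B \<in> \<X>" and t: "\<And>X. X \<in> \<X> \<Longrightarrow> trivial_Ext C X"
  shows "left_approximation \<C> \<X> A x B"
proof -
  note x = conflation_objs(4)[OF c]
  have "(\<lambda>g. g \<cdot> x) ` Hom B X = Hom A X" if "X \<in> \<X>" for X
  proof (intro equalityI subsetI)
    show "f \<in> Hom A X" if "f \<in> (\<lambda>g. g \<cdot> x) ` Hom B X" for f
      using that comp_in_Hom[OF x] by blast
    show "f \<in> (\<lambda>g. g \<cdot> x) ` Hom B X" if "f \<in> Hom A X" for f
      using extend_if_trivial_Ext[OF c t[OF \<open>X \<in> \<X>\<close>] that] by blast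
  qed
  then show ?thesis
    unfolding left_approximation_def using x B by blast
qed

lemma projective_lift:
  assumes "projective \<C> P" "deflation \<C> y" "y \<in> Hom B C" "f \<in> Hom P C"
  obtains g where "g \<in> Hom P B" "y \<cdot> g = f"
proof -
  have "f \<in> (\<lambda>g. y \<cdot> g) ` Hom P B"
    using assms unfolding projective_def by simp
  then show thesis using that by (auto simp only: image_iff)
qed

lemma injective_extend:
  assumes "injective \<C> I" "inflation \<C> x" "x \<in> Hom A B" "f \<in> Hom A I"
  obtains g where "g \<in> Hom B I" "g \<cdot> x = f"
proof -
  have "f \<in> (\<lambda>g. g \<cdot> x) ` Hom B I"
    using assms unfolding injective_def by simp
  then show thesis using that by (auto simp only: image_iff)
qed

text \<open>
  The deflation that realizes \<open>\<delta>\<close> has a section, which compares \<open>\<delta>\<close> with the extension realized by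
  \<open>0 \<rightarrow> P \<rightarrow> P\<close>; hence \<open>\<delta>\<close> is the push-forward of an extension by \<open>0\<close>, so zero. The next lemma is the
  dual.
\<close>

lemma projective_trivial_Ext:
  assumes P: "projective \<C> P" and A: "A \<in> Obj \<C>"
  shows "trivial_Ext P A"
proof (rule trivial_ExtI)
  show o: "P \<in> Obj \<C>" using P unfolding projective_def by simp
  fix \<delta> assume \<delta>: "\<delta> \<in> carrier (Ext \<C> P A)"
  obtain u E v where E: "realizes \<C> \<delta> A u E v P"
    using realization_exists[OF o A \<delta>] .
  note v = realizes_objs(6)[OF E]
  have "deflation \<C> v"
    using E unfolding deflation_def conflation_def by blast
  then obtain s where s: "s \<in> Hom P E" "v \<cdot> s = ident \<C> P"
    using projective_lift[OF P _ v ident_in_Hom[OF o]] by blast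
  obtain Z where Z: "zero_object \<C> Z"
    using zero_object_exists by blast
  have r: "realizes \<C> \<one>\<^bsub>Ext \<C> P Z\<^esub> Z (hzero \<C> Z P) P (ident \<C> P) P"
    using realization_zero biproduct_zero_left[OF Z] ident_in_Hom[OF o] comp_ident by blast
  obtain a where "ext_morphism \<C> P Z \<one>\<^bsub>Ext \<C> P Z\<^esub> P A \<delta> a (ident \<C> P)"
    using ET3_op[OF r E s(1) ident_in_Hom[OF o]] s(2) comp_ident[OF ident_in_Hom[OF o]] by auto
  then show "\<delta> = \<one>\<^bsub>Ext \<C> P A\<^esub>"
    using push_one[OF o] pull_ident[OF o A \<delta>] unfolding ext_morphism_def by auto
qed (rule A)

lemma injective_trivial_Ext:
  assumes I: "injective \<C> I" and C: "C \<in> Obj \<C>"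
  shows "trivial_Ext C I"
proof (rule trivial_ExtI)
  show o: "I \<in> Obj \<C>" using I unfolding injective_def by simp
  fix \<delta> assume \<delta>: "\<delta> \<in> carrier (Ext \<C> C I)"
  obtain u E v where E: "realizes \<C> \<delta> I u E v C"
    using realization_exists[OF C o \<delta>] .
  note u = realizes_objs(5)[OF E]
  have "inflation \<C> u"
    using E unfolding inflation_def conflation_def by blast
  then obtain s where s: "s \<in> Hom E I" "s \<cdot> u = ident \<C> I"
    using injective_extend[OF I _ u ident_in_Hom[OF o]] by blast
  obtain Z where Z: "zero_object \<C> Z"
    using zero_object_exists by blast
  have r: "realizes \<C> \<one>\<^bsub>Ext \<C> Z I\<^esub> I (ident \<C> I) I (hzero \<C> I Z) Z"
    using realization_zero[OF biproduct_zero_right[OF Z o]] .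
  obtain c where "ext_morphism \<C> C I \<delta> Z I \<one>\<^bsub>Ext \<C> Z I\<^esub> (ident \<C> I) c"
    using ET3[OF E r ident_in_Hom[OF o] s(1)] s(2) comp_ident[OF ident_in_Hom[OF o]] by auto
  then show "\<delta> = \<one>\<^bsub>Ext \<C> C I\<^esub>"
    using pull_one[OF o] push_ident[OF C o \<delta>] unfolding ext_morphism_def by auto
qed (rule C)

lemma projective_if_trivial_Ext:
  assumes o: "P \<in> Obj \<C>" and t: "\<And>A. A \<in> Obj \<C> \<Longrightarrow> trivial_Ext P A"
  shows "projective \<C> P"
proof -
  have "(\<lambda>f. y \<cdot> f) ` Hom P B = Hom P C" if y: "y \<in> Hom B C" "deflation \<C> y" for B C y
  proof (intro equalityI subsetI)
    obtain A x where c: "conflation \<C> A x B y C"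
      using deflation_conflation[OF y(2,1)] .
    show "f \<in> Hom P C" if "f \<in> (\<lambda>f. y \<cdot> f) ` Hom P B" for f
      using that comp_in_Hom y(1) by blast
    show "f \<in> (\<lambda>f. y \<cdot> f) ` Hom P B" if "f \<in> Hom P C" for f
      using lift_if_trivial_Ext[OF c t[OF conflation_objs(1)[OF c]] that] by blast
  qed
  then show ?thesis
    unfolding projective_def using o by blast
qed

lemma zero_object_projective: "zero_object \<C> Z \<Longrightarrow> projective \<C> Z"
  using projective_if_trivial_Ext trivial_Ext_zero_left unfolding zero_object_def by blast

lemma trivial_Ext_extension_left:
  assumes c: "conflation \<C> A x B y C" and X: "X \<in> Obj \<C>" and t: "trivial_Ext A X" "trivial_Ext C X"
  shows "trivial_Ext B X"
proof (rule trivial_ExtI[OF conflation_objs(2)[OF c] X])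
  fix \<delta> assume \<delta>: "\<delta> \<in> carrier (Ext \<C> B X)"
  obtain \<theta> where \<theta>: "realizes \<C> \<theta> A x B y C"
    using c by (rule conflation_realizes)
  note o = realizes_objs[OF \<theta>]
  obtain \<epsilon> where "\<epsilon> \<in> carrier (Ext \<C> C X)" "\<delta> = pull \<C> X y \<epsilon>"
    using pull_exact_middle[OF \<theta> X \<delta> trivial_ExtD[OF t(1) pull_closed[OF X o(5) \<delta>]]] .
  then show "\<delta> = \<one>\<^bsub>Ext \<C> B X\<^esub>"
    using trivial_ExtD[OF t(2)] pull_one[OF X o(6)] by simp
qed

lemma trivial_Ext_extension_right:
  assumes c: "conflation \<C> A x B y C" and W: "W \<in> Obj \<C>" and t: "trivial_Ext W A" "trivial_Ext W C"
  shows "trivial_Ext W B"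
proof (rule trivial_ExtI[OF W conflation_objs(2)[OF c]])
  fix \<delta> assume \<delta>: "\<delta> \<in> carrier (Ext \<C> W B)"
  obtain \<theta> where \<theta>: "realizes \<C> \<theta> A x B y C"
    using c by (rule conflation_realizes)
  note o = realizes_objs[OF \<theta>]
  obtain \<epsilon> where "\<epsilon> \<in> carrier (Ext \<C> W A)" "\<delta> = push \<C> W x \<epsilon>"
    using push_exact_middle[OF \<theta> W \<delta> trivial_ExtD[OF t(2) push_closed[OF W o(6) \<delta>]]] .
  then show "\<delta> = \<one>\<^bsub>Ext \<C> W B\<^esub>"
    using trivial_ExtD[OF t(1)] push_one[OF W o(5)] by simp
qed

lemma trivial_Ext_retract:
  assumes h: "s \<in> Hom A S" "r \<in> Hom S A" "r \<cdot> s = ident \<C> A" and X: "X \<in> Obj \<C>" and t: "trivial_Ext S X"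
  shows "trivial_Ext A X"
proof (rule trivial_ExtI[OF Hom_src_in_Obj[OF h(1)] X])
  fix \<delta> assume \<delta>: "\<delta> \<in> carrier (Ext \<C> A X)"
  have "\<delta> = pull \<C> X s (pull \<C> X r \<delta>)"
    using pull_pull[OF X h(2,1) \<delta>] h(3) pull_ident[OF Hom_src_in_Obj[OF h(1)] X \<delta>] by simp
  also have "\<dots> = \<one>\<^bsub>Ext \<C> A X\<^esub>"
    using trivial_ExtD[OF t pull_closed[OF X h(2) \<delta>]] pull_one[OF X h(1)] by simp
  finally show "\<delta> = \<one>\<^bsub>Ext \<C> A X\<^esub>" .
qed

text \<open>
  Right exactness of \<open>\<bbbE>(T, -)\<close> when \<open>T\<close> has projective dimension at most one. As \<open>P\<^sub>0\<close> is projective,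
  every extension of \<open>T\<close> by \<open>C\<close> is a push-forward of the presentation of \<open>T\<close> along some \<open>P\<^sub>1 \<rightarrow> C\<close>,
  and as \<open>P\<^sub>1\<close> is projective, this arrow lifts to \<open>B\<close>.
\<close>

lemma trivial_Ext_deflation:
  assumes c: "conflation \<C> P\<^sub>1 i P\<^sub>0 \<pi> T" "projective \<C> P\<^sub>1" "projective \<C> P\<^sub>0"
    and y: "deflation \<C> y" "y \<in> Hom B C" and t: "trivial_Ext T B"
  shows "trivial_Ext T C"
proof -
  note o = conflation_objs[OF c(1)] Hom_src_in_Obj[OF y(2)] Hom_tgt_in_Obj[OF y(2)]
  show ?thesis
  proof (rule trivial_ExtI[OF o(3,7)])
    fix \<delta> assume \<delta>: "\<delta> \<in> carrier (Ext \<C> T C)"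
    obtain \<theta> where \<theta>: "realizes \<C> \<theta> P\<^sub>1 i P\<^sub>0 \<pi> T"
      using c(1) by (rule conflation_realizes)
    have "pull \<C> C \<pi> \<delta> = \<one>\<^bsub>Ext \<C> P\<^sub>0 C\<^esub>"
      using trivial_ExtD[OF projective_trivial_Ext[OF c(3) o(7)] pull_closed[OF o(7,5) \<delta>]] .
    then obtain f where f: "f \<in> Hom P\<^sub>1 C" "\<delta> = push \<C> T f \<theta>"
      using push_of_connecting[OF \<theta> o(7) \<delta>] by blast
    obtain g where g: "g \<in> Hom P\<^sub>1 B" "y \<cdot> g = f"
      using projective_lift[OF c(2) y f(1)] .
    note \<theta>' = realizes_objs(4)[OF \<theta>]
    have "\<delta> = push \<C> T y (push \<C> T g \<theta>)"
      using f(2) g push_push[OF o(3) g(1) y(2) \<theta>'] by simp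
    also have "\<dots> = \<one>\<^bsub>Ext \<C> T C\<^esub>"
      using trivial_ExtD[OF t push_closed[OF o(3) g(1) \<theta>']] push_one[OF o(3) y(2)] by simp
    finally show "\<delta> = \<one>\<^bsub>Ext \<C> T C\<^esub>" .
  qed
qed

section \<open>Quotients and left perpendicular subcategories\<close>

lemma DeflI: "\<lbrakk>U \<in> \<U>; y \<in> Hom U F; deflation \<C> y\<rbrakk> \<Longrightarrow> F \<in> Defl \<C> \<U>"
  unfolding Defl_def using Hom_tgt_in_Obj by blast

lemma DeflE:
  assumes "F \<in> Defl \<C> \<U>"
  obtains U y where "U \<in> \<U>" "y \<in> Hom U F" "deflation \<C> y"
  using assms unfolding Defl_def by blast

lemma Defl_subset_Obj: "Defl \<C> \<U> \<subseteq> Obj \<C>"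
  unfolding Defl_def by blast

lemma subset_Defl:
  assumes "\<U> \<subseteq> Obj \<C>"
  shows "\<U> \<subseteq> Defl \<C> \<U>"
proof
  fix U assume U: "U \<in> \<U>"
  then have o: "U \<in> Obj \<C>" using assms by blast
  show "U \<in> Defl \<C> \<U>"
    using DeflI[OF U ident_in_Hom[OF o] iso_deflation[OF ident_iso[OF o] ident_in_Hom[OF o]]] .
qed

lemma Defl_deflation:
  assumes F: "F \<in> Defl \<C> \<U>" and y: "y \<in> Hom F G" "deflation \<C> y"
  shows "G \<in> Defl \<C> \<U>"
proof -
  obtain U z where z: "U \<in> \<U>" "z \<in> Hom U F" "deflation \<C> z"
    using F by (rule DeflE)
  show ?thesis
    using DeflI[OF z(1) comp_in_Hom[OF z(2) y(1)] deflation_comp[OF z(3,2) y(2,1)]] .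
qed

lemma Defl_conflation:
  assumes "conflation \<C> A x B y C" "B \<in> Defl \<C> \<U>"
  shows "C \<in> Defl \<C> \<U>"
  using Defl_deflation[OF assms(2) conflation_objs(5)[OF assms(1)] conflation_deflation[OF assms(1)]] .

lemma subcategory_Defl: "subcategory \<C> (Defl \<C> \<U>)"
proof -
  have "Y \<in> Defl \<C> \<U>" if X: "X \<in> Defl \<C> \<U>" and f: "isomorphic \<C> X Y" for X Y
  proof -
    obtain f where "f \<in> Hom X Y" "iso_arrow \<C> f"
      using f unfolding isomorphic_def by blast
    then show ?thesis using Defl_deflation[OF X] iso_deflation by blast
  qed
  then show ?thesis
    unfolding subcategory_def using Defl_subset_Obj by blast
qed

lemma closed_under_deflations_Defl: "closed_under_deflations \<C> (Defl \<C> \<U>)"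
proof -
  have "Defl \<C> (Defl \<C> \<U>) \<subseteq> Defl \<C> \<U>"
    using Defl_deflation by (blast elim: DeflE)
  then show ?thesis
    unfolding closed_under_deflations_def using subset_Defl[OF Defl_subset_Obj] by blast
qed

text \<open>
  The projections of a biproduct are deflations.
\<close>

lemma closed_under_summands_if_closed_under_deflations:
  assumes "closed_under_deflations \<C> \<V>"
  shows "closed_under_summands \<C> \<V>"
  unfolding closed_under_summands_def
proof (intro allI impI, elim conjE)
  fix A B S i j p q
  assume S: "biproduct \<C> A B S i j p q" "S \<in> \<V>"
  then have "S \<in> Defl \<C> \<V>" using assms unfolding closed_under_deflations_def by simp
  then have "B \<in> Defl \<C> \<V>" "A \<in> Defl \<C> \<V>"
    using Defl_conflation biproduct_conflation[OF S(1)]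
      biproduct_conflation[OF biproduct_commute[OF S(1)]] by blast+
  then show "A \<in> \<V> \<and> B \<in> \<V>"
    using assms unfolding closed_under_deflations_def by simp
qed

lemma left_perpI: "\<lbrakk>X \<in> Obj \<C>; \<And>V. V \<in> \<V> \<Longrightarrow> trivial_Ext X V\<rbrakk> \<Longrightarrow> X \<in> left_perp \<C> \<V>"
  unfolding left_perp_def by blast

lemma left_perpD: "\<lbrakk>X \<in> left_perp \<C> \<V>; V \<in> \<V>\<rbrakk> \<Longrightarrow> trivial_Ext X V"
  unfolding left_perp_def by blast

lemma left_perp_subset_Obj: "left_perp \<C> \<V> \<subseteq> Obj \<C>"
  unfolding left_perp_def by blast

lemma projective_in_left_perp:
  assumes "\<V> \<subseteq> Obj \<C>" "projective \<C> P"
  shows "P \<in> left_perp \<C> \<V>"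
proof (rule left_perpI)
  show "P \<in> Obj \<C>"
    using assms(2) unfolding projective_def by simp
  show "trivial_Ext P V" if "V \<in> \<V>" for V
    using projective_trivial_Ext[OF assms(2)] assms(1) that by blast
qed

lemma left_perp_retract:
  assumes V: "\<V> \<subseteq> Obj \<C>" and S: "S \<in> left_perp \<C> \<V>"
    and h: "s \<in> Hom A S" "r \<in> Hom S A" "r \<cdot> s = ident \<C> A"
  shows "A \<in> left_perp \<C> \<V>"
proof (rule left_perpI)
  show "A \<in> Obj \<C>" using h(1) by (rule Hom_src_in_Obj)
  fix X assume "X \<in> \<V>"
  then show "trivial_Ext A X"
    using trivial_Ext_retract[OF h _ left_perpD[OF S]] V by blast
qed

lemma subcategory_left_perp:
  assumes "\<V> \<subseteq> Obj \<C>"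
  shows "subcategory \<C> (left_perp \<C> \<V>)"
proof -
  have "Y \<in> left_perp \<C> \<V>" if X: "X \<in> left_perp \<C> \<V>" and XY: "isomorphic \<C> X Y" for X Y
  proof -
    obtain f where f: "f \<in> Hom X Y" "iso_arrow \<C> f"
      using XY unfolding isomorphic_def by blast
    obtain g where "g \<in> Hom Y X" "g \<cdot> f = ident \<C> X" "f \<cdot> g = ident \<C> Y"
      using iso_arrow_inverse[OF f(2,1)] .
    then show ?thesis using left_perp_retract[OF assms X] f(1) by blast
  qed
  then show ?thesis
    unfolding subcategory_def using left_perp_subset_Obj by blast
qed

lemma closed_under_summands_left_perp:
  assumes "\<V> \<subseteq> Obj \<C>"
  shows "closed_under_summands \<C> (left_perp \<C> \<V>)"
  unfolding closed_under_summands_def biproduct_def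
  using left_perp_retract[OF assms] by blast

lemma closed_under_extensions_left_perp:
  assumes "\<V> \<subseteq> Obj \<C>"
  shows "closed_under_extensions \<C> (left_perp \<C> \<V>)"
  unfolding closed_under_extensions_def
proof (intro allI impI, elim conjE)
  fix A x B y C
  assume c: "conflation \<C> A x B y C" "A \<in> left_perp \<C> \<V>" "C \<in> left_perp \<C> \<V>"
  show "B \<in> left_perp \<C> \<V>"
    using trivial_Ext_extension_left[OF c(1) _ left_perpD[OF c(2)] left_perpD[OF c(3)]] assms
    by (intro left_perpI conflation_objs(2)[OF c(1)]) blast
qed

lemma closed_under_extensionsD:
  "\<lbrakk>closed_under_extensions \<C> \<X>; conflation \<C> A x B y C; A \<in> \<X>; C \<in> \<X>\<rbrakk> \<Longrightarrow> B \<in> \<X>"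
  unfolding closed_under_extensions_def by blast

lemma split_conflation_summand:
  assumes "closed_under_summands \<C> \<X>" "conflation \<C> A x B y C" "trivial_Ext C A" "B \<in> \<X>"
  shows "A \<in> \<X>" "C \<in> \<X>"
proof -
  obtain j p where "biproduct \<C> A C B x j p y"
    using split_conflation_biproduct[OF assms(2,3)] .
  then show "A \<in> \<X>" "C \<in> \<X>"
    using assms(1,4) unfolding closed_under_summands_def by blast+
qed

section \<open>Projective dimension at most one\<close>

lemma Inf_enat_in: "S \<noteq> {} \<Longrightarrow> Inf S \<in> (S :: enat set)"
  unfolding Inf_enat_def using LeastI by force

lemma pd_le_oneI:
  assumes c: "conflation \<C> P\<^sub>1 x P\<^sub>0 y A" and P: "projective \<C> P\<^sub>1" "projective \<C> P\<^sub>0"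
  shows "pd \<C> A \<le> 1"
proof -
  obtain Z where Z: "zero_object \<C> Z"
    using zero_object_exists by blast
  then have ZO: "Z \<in> Obj \<C>" unfolding zero_object_def by simp
  define Q where "Q i = (if i = 0 then P\<^sub>0 else if i = 1 then P\<^sub>1 else Z)" for i :: nat
  define K where "K i = (if i = 0 then A else if i = 1 then P\<^sub>1 else Z)" for i :: nat
  have "projective_resolution \<C> A Q K"
    unfolding projective_resolution_def
  proof (intro conjI allI)
    fix i :: nat
    show "projective \<C> (Q i)"
      unfolding Q_def using P zero_object_projective[OF Z] by simp
    consider "i = 0" | "i = 1" | "i > 1" by linarith
    then show "\<exists>x y. conflation \<C> (K (Suc i)) x (Q i) y (K i)"
      using c conflation_zero_ident[OF Z conflation_objs(1)[OF c]] conflation_zero_ident[OF Z ZO]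
      by cases (auto simp: Q_def K_def)
  qed (simp add: K_def)
  then have "pd \<C> A \<le> resolution_length \<C> K"
    unfolding pd_def by (intro Inf_lower) blast
  also have "\<dots> \<le> enat 1"
    unfolding resolution_length_def using Z by (intro Inf_lower) (auto simp: K_def)
  finally show ?thesis by (simp add: one_enat_def)
qed

text \<open>
  A resolution of length at most one stops with \<open>K 2 = 0\<close>, and the conflation \<open>0 \<rightarrow> P 1 \<rightarrow> K 1\<close> makes
  the syzygy \<open>K 1\<close> projective.
\<close>

lemma pd_le_oneE:
  assumes "pd \<C> A \<le> 1"
  obtains P\<^sub>1 x P\<^sub>0 y where "projective \<C> P\<^sub>1" "projective \<C> P\<^sub>0" "conflation \<C> P\<^sub>1 x P\<^sub>0 y A"
proof -
  let ?S = "{resolution_length \<C> K |P K. projective_resolution \<C> A P K}"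
  have "?S \<noteq> {}"
  proof
    assume "?S = {}"
    then have "pd \<C> A = Inf {}" unfolding pd_def by (rule arg_cong)
    then show False using assms by (simp add: Inf_enat_def)
  qed
  then obtain P K where K: "projective_resolution \<C> A P K" "resolution_length \<C> K \<le> 1"
    using Inf_enat_in[of ?S] assms unfolding pd_def by auto
  let ?L = "{enat n |n. \<forall>i>n. zero_object \<C> (K i)}"
  have "?L \<noteq> {}"
  proof
    assume "?L = {}"
    then have "resolution_length \<C> K = Inf {}" unfolding resolution_length_def by (rule arg_cong)
    then show False using K(2) by (simp add: Inf_enat_def)
  qed
  then obtain n where n: "\<forall>i>n. zero_object \<C> (K i)" "enat n \<le> 1"
    using Inf_enat_in[of ?L] K(2) unfolding resolution_length_def by auto
  have Z: "zero_object \<C> (K 2)"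
    using n by (simp add: one_enat_def)
  have r: "projective \<C> (P i)" "\<exists>x y. conflation \<C> (K (Suc i)) x (P i) y (K i)" for i
    using K(1) unfolding projective_resolution_def by auto
  obtain x y where c: "conflation \<C> (K 1) x (P 0) y A"
    using r(2)[of 0] K(1) unfolding projective_resolution_def by auto
  obtain u v where d: "conflation \<C> (K 2) u (P 1) v (K 1)"
    using r(2)[of 1] by (auto simp: numeral_2_eq_2)
  obtain \<theta> where \<theta>: "realizes \<C> \<theta> (K 2) u (P 1) v (K 1)"
    using d by (rule conflation_realizes)
  note o = realizes_objs[OF \<theta>]
  \<comment> \<open>extensions of \<open>K 1\<close> are push-forwards along arrows that start at the zero object \<open>K 2\<close>\<close>
  have "projective \<C> (K 1)"
  proof (rule projective_if_trivial_Ext[OF o(3)], rule trivial_ExtI[OF o(3)])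
    fix X \<delta> assume X: "X \<in> Obj \<C>" and \<delta>: "\<delta> \<in> carrier (Ext \<C> (K 1) X)"
    obtain f where f: "f \<in> Hom (K 2) X" "\<delta> = push \<C> (K 1) f \<theta>"
      using push_of_connecting[OF \<theta> X \<delta>
          trivial_ExtD[OF projective_trivial_Ext[OF r(1) X] pull_closed[OF X o(6) \<delta>]]] .
    have "f = hzero \<C> (K 2) X"
      using zero_object_Hom_unique'[OF Z f(1) hzero_in_Hom[OF o(1) X]] .
    then show "\<delta> = \<one>\<^bsub>Ext \<C> (K 1) X\<^esub>"
      using f(2) push_hzero[OF o(3,1) X o(4)] by simp
  qed
  then show thesis using that r(1) c by blast
qed

lemma enough_projectives_conflation:
  assumes "enough_projectives \<C>" "A \<in> Obj \<C>"
  obtains K x P y where "projective \<C> P" "conflation \<C> K x P y A"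
  using assms deflation_conflation unfolding enough_projectives_def by metis

lemma enough_injectives_conflation:
  assumes "enough_injectives \<C>" "A \<in> Obj \<C>"
  obtains I x y C where "injective \<C> I" "conflation \<C> A x I y C"
  using assms inflation_conflation unfolding enough_injectives_def by metis

section \<open>Tilting subcategories\<close>

lemma tiltingD:
  assumes "tilting \<C> \<T>"
  shows "subcategory \<C> \<T>" "\<T> \<subseteq> Obj \<C>" "closed_under_summands \<C> \<T>" "closed_under_finite_sums \<C> \<T>"
    "Ext_vanishes \<C> \<T> \<T>"
  using assms unfolding tilting_def subcategory_def by blast+

lemma tilting_resolution:
  assumes "tilting \<C> \<T>" "T \<in> \<T>"
  obtains P\<^sub>1 x P\<^sub>0 y where "projective \<C> P\<^sub>1" "projective \<C> P\<^sub>0" "conflation \<C> P\<^sub>1 x P\<^sub>0 y T"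
proof -
  have "pd \<C> T \<le> 1"
    using assms unfolding tilting_def pd_subcategory_def by (simp add: SUP_le_iff)
  then show thesis using that by (rule pd_le_oneE)
qed

lemma tilting_coresolution:
  assumes "tilting \<C> \<T>" "projective \<C> P"
  obtains T\<^sub>0 T\<^sub>1 x y where "T\<^sub>0 \<in> \<T>" "T\<^sub>1 \<in> \<T>" "conflation \<C> P x T\<^sub>0 y T\<^sub>1"
  using assms unfolding tilting_def by blast

lemma tilting_trivial_Ext_Defl:
  assumes T: "tilting \<C> \<T>" and X: "X \<in> \<T>" and F: "F \<in> Defl \<C> \<T>"
  shows "trivial_Ext X F"
proof -
  obtain P\<^sub>1 x P\<^sub>0 y where P: "projective \<C> P\<^sub>1" "projective \<C> P\<^sub>0" "conflation \<C> P\<^sub>1 x P\<^sub>0 y X"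
    using tilting_resolution[OF T X] .
  obtain U z where U: "U \<in> \<T>" "z \<in> Hom U F" "deflation \<C> z"
    using F by (rule DeflE)
  have "trivial_Ext X U"
    using tiltingD(5)[OF T] X U(1) unfolding Ext_vanishes_def by blast
  then show ?thesis
    using trivial_Ext_deflation[OF P(3,1,2) U(3,2)] by blast
qed

lemma tilting_left_perp: "tilting \<C> \<T> \<Longrightarrow> \<T> \<subseteq> left_perp \<C> (Defl \<C> \<T>)"
  using tilting_trivial_Ext_Defl tiltingD(2) unfolding left_perp_def by blast

text \<open>
  The coresolution \<open>P \<rightarrow> T\<^sub>0 \<rightarrow> T\<^sub>1\<close> of a projective \<open>P\<close> with a deflation to \<open>C\<close> is transported along \<open>P \<rightarrow> C\<close>;
  the new middle term is a quotient of \<open>T\<^sub>0\<close> by the kernel of \<open>P \<rightarrow> C\<close>.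
\<close>

lemma tilting_Defl_coresolution:
  assumes ep: "enough_projectives \<C>" and T: "tilting \<C> \<T>" and C: "C \<in> Obj \<C>"
  obtains E T\<^sub>1 x y where "E \<in> Defl \<C> \<T>" "T\<^sub>1 \<in> \<T>" "conflation \<C> C x E y T\<^sub>1"
proof -
  obtain K k P p where P: "projective \<C> P" "conflation \<C> K k P p C"
    using enough_projectives_conflation[OF ep C] .
  obtain T\<^sub>0 T\<^sub>1 f g where f: "T\<^sub>0 \<in> \<T>" "T\<^sub>1 \<in> \<T>" "conflation \<C> P f T\<^sub>0 g T\<^sub>1"
    using tilting_coresolution[OF T P(1)] .
  obtain E h d e where E: "conflation \<C> K (f \<cdot> k) T\<^sub>0 h E" "conflation \<C> C d E e T\<^sub>1"
    using conflation_cobase_change[OF P(2) f(3)] .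
  have "E \<in> Defl \<C> \<T>"
    using DeflI[OF f(1) conflation_objs(5)[OF E(1)] conflation_deflation[OF E(1)]] .
  then show thesis using that f(2) E(2) by blast
qed

text \<open>
  If \<open>\<bbbE>(\<T>, X) = 0\<close>, then the coresolution \<open>X \<rightarrow> E \<rightarrow> T\<^sub>1\<close> splits, so \<open>X\<close> is a summand of the quotient
  \<open>E\<close>. This description of the quotients by vanishing is what makes them closed under extensions.
\<close>

lemma tilting_Defl_eq:
  assumes ep: "enough_projectives \<C>" and T: "tilting \<C> \<T>"
  shows "Defl \<C> \<T> = {X \<in> Obj \<C>. \<forall>T \<in> \<T>. trivial_Ext T X}"
proof (intro equalityI subsetI)
  fix X assume "X \<in> Defl \<C> \<T>"
  then show "X \<in> {X \<in> Obj \<C>. \<forall>T \<in> \<T>. trivial_Ext T X}"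
    using tilting_trivial_Ext_Defl[OF T] Defl_subset_Obj by blast
next
  fix X assume X: "X \<in> {X \<in> Obj \<C>. \<forall>T \<in> \<T>. trivial_Ext T X}"
  then obtain E T\<^sub>1 x y where E: "E \<in> Defl \<C> \<T>" "T\<^sub>1 \<in> \<T>" "conflation \<C> X x E y T\<^sub>1"
    using tilting_Defl_coresolution[OF ep T] by blast
  have "trivial_Ext T\<^sub>1 X" using X E(2) by blast
  then show "X \<in> Defl \<C> \<T>"
    using split_conflation_summand(1)[OF closed_under_summands_if_closed_under_deflations
        [OF closed_under_deflations_Defl] E(3)] E(1) by blast
qed

lemma tilting_torsion_class:
  assumes ep: "enough_projectives \<C>" and T: "tilting \<C> \<T>"
  shows "torsion_class \<C> (Defl \<C> \<T>)"
proof -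
  have "closed_under_extensions \<C> (Defl \<C> \<T>)"
    unfolding closed_under_extensions_def
  proof (intro allI impI, elim conjE)
    fix A x B y C
    assume c: "conflation \<C> A x B y C" and AC: "A \<in> Defl \<C> \<T>" "C \<in> Defl \<C> \<T>"
    have "trivial_Ext X B" if "X \<in> \<T>" for X
      using trivial_Ext_extension_right[OF c _ tilting_trivial_Ext_Defl[OF T that AC(1)]
          tilting_trivial_Ext_Defl[OF T that AC(2)]] that tiltingD(2)[OF T] by blast
    then show "B \<in> Defl \<C> \<T>"
      unfolding tilting_Defl_eq[OF ep T] using conflation_objs(2)[OF c] by blast
  qed
  then show ?thesis
    unfolding torsion_class_def using subcategory_Defl closed_under_deflations_Defl by blast
qed

text \<open>
  Given a deflation \<open>U \<rightarrow> V\<close> with kernel \<open>M\<close>, coresolve \<open>M \<rightarrow> E \<rightarrow> T\<^sub>1\<close> and form the pushout \<open>G\<close> of \<open>U\<close>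
  and \<open>E\<close> under \<open>M\<close>. As an extension of \<open>T\<^sub>1\<close> by \<open>U\<close> it splits, so it belongs to \<open>\<T>\<close>; as an
  extension of \<open>V\<close> by \<open>E\<close> it is the desired conflation.
\<close>

lemma tilting_generator:
  assumes ep: "enough_projectives \<C>" and T: "tilting \<C> \<T>"
  shows "generator \<C> \<T> (Defl \<C> \<T>)"
proof -
  have "\<exists>V' \<in> Defl \<C> \<T>. \<exists>U \<in> \<T>. \<exists>x y. conflation \<C> V' x U y V" if V: "V \<in> Defl \<C> \<T>" for V
  proof -
    obtain U z where U: "U \<in> \<T>" "z \<in> Hom U V" "deflation \<C> z"
      using V by (rule DeflE)
    obtain M m where M: "conflation \<C> M m U z V"
      using deflation_conflation[OF U(3,2)] .
    obtain E T\<^sub>1 x y where E: "E \<in> Defl \<C> \<T>" "T\<^sub>1 \<in> \<T>" "conflation \<C> M x E y T\<^sub>1"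
      using tilting_Defl_coresolution[OF ep T conflation_objs(1)[OF M]] .
    obtain G U' E' a b c d where G: "isomorphic \<C> U U'" "conflation \<C> U' a G b T\<^sub>1"
      "isomorphic \<C> E E'" "conflation \<C> E' c G d V"
      using conflation_pushout[OF M E(3)] .
    have U': "U' \<in> \<T>"
      using subcategory_isomorphic[OF tiltingD(1)[OF T] U(1) G(1)] .
    then have "trivial_Ext T\<^sub>1 U'"
      using tiltingD(5)[OF T] E(2) unfolding Ext_vanishes_def by blast
    then obtain j p where "biproduct \<C> U' T\<^sub>1 G a j p b"
      using split_conflation_biproduct[OF G(2)] by blast
    then have "G \<in> \<T>"
      using tiltingD(4)[OF T] U' E(2) unfolding closed_under_finite_sums_def by blast
    then show ?thesis
      using G(4) subcategory_isomorphic[OF subcategory_Defl E(1) G(3)] by blast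
  qed
  then show ?thesis
    unfolding generator_def using subset_Defl[OF tiltingD(2)[OF T]] by blast
qed

lemma tilting_imp_support_tau_tilting:
  assumes ep: "enough_projectives \<C>" and T: "tilting \<C> \<T>"
  shows "support_tau_tilting \<C> \<T>"
proof -
  have "Ext_vanishes \<C> \<T> (Defl \<C> \<T>)"
    unfolding Ext_vanishes_def using tilting_trivial_Ext_Defl[OF T] by blast
  moreover have "\<exists>T0 \<in> \<T>. \<exists>T1 \<in> \<T>. \<exists>f g.
      right_exact_triangle \<C> P f T0 g T1 \<and> left_approximation \<C> \<T> P f T0"
    if P: "projective \<C> P" for P
  proof -
    obtain T\<^sub>0 T\<^sub>1 f g where f: "T\<^sub>0 \<in> \<T>" "T\<^sub>1 \<in> \<T>" "conflation \<C> P f T\<^sub>0 g T\<^sub>1"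
      using tilting_coresolution[OF T P] .
    have "left_approximation \<C> \<T> P f T\<^sub>0"
      using inflation_left_approximation[OF f(3,1)] tiltingD(5)[OF T] f(2)
      unfolding Ext_vanishes_def by blast
    then show ?thesis using f conflation_right_exact by blast
  qed
  ultimately show ?thesis
    unfolding support_tau_tilting_def using tiltingD(1,3,4)[OF T] tilting_generator[OF ep T] by blast
qed

lemma tilting_left_perp_inter_Defl:
  assumes ep: "enough_projectives \<C>" and T: "tilting \<C> \<T>"
  shows "left_perp \<C> (Defl \<C> \<T>) \<inter> Defl \<C> \<T> = \<T>"
proof (intro equalityI subsetI)
  fix X assume X: "X \<in> left_perp \<C> (Defl \<C> \<T>) \<inter> Defl \<C> \<T>"
  then obtain V U x y where V: "V \<in> Defl \<C> \<T>" "U \<in> \<T>" "conflation \<C> V x U y X"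
    using tilting_generator[OF ep T] unfolding generator_def by blast
  have "trivial_Ext X V"
    using X left_perpD V(1) by blast
  then show "X \<in> \<T>"
    using split_conflation_summand(2)[OF tiltingD(3)[OF T] V(3)] V(2) by blast
next
  fix X assume "X \<in> \<T>"
  then show "X \<in> left_perp \<C> (Defl \<C> \<T>) \<inter> Defl \<C> \<T>"
    using tilting_left_perp[OF T] subset_Defl[OF tiltingD(2)[OF T]] by blast
qed

text \<open>
  The right approximation of \<open>C\<close> comes from the left approximation \<open>K \<rightarrow> V \<rightarrow> U\<close> of the kernel of a
  deflation \<open>P \<rightarrow> C\<close> with \<open>P\<close> projective: the pushout \<open>M\<close> of \<open>P\<close> and \<open>V\<close> under \<open>K\<close> is an extension of
  \<open>U\<close> by \<open>P\<close>, and both lie in the left perpendicular subcategory.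
\<close>

lemma tilting_imp_cotorsion_pair:
  assumes ep: "enough_projectives \<C>" and T: "tilting \<C> \<T>"
  shows "cotorsion_pair \<C> (left_perp \<C> (Defl \<C> \<T>)) (Defl \<C> \<T>)"
proof -
  let ?V = "Defl \<C> \<T>" and ?U = "left_perp \<C> (Defl \<C> \<T>)"
  have co: "\<exists>V \<in> ?V. \<exists>U \<in> ?U. \<exists>x y. conflation \<C> C x V y U" if C: "C \<in> Obj \<C>" for C
  proof -
    obtain V U x y where "V \<in> ?V" "U \<in> \<T>" "conflation \<C> C x V y U"
      using tilting_Defl_coresolution[OF ep T C] .
    then show ?thesis using tilting_left_perp[OF T] by blast
  qed
  have "\<exists>V \<in> ?V. \<exists>U \<in> ?U. \<exists>x y. conflation \<C> V x U y C" if C: "C \<in> Obj \<C>" for C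
  proof -
    obtain K k P p where P: "projective \<C> P" "conflation \<C> K k P p C"
      using enough_projectives_conflation[OF ep C] .
    obtain V U x y where V: "V \<in> ?V" "U \<in> ?U" "conflation \<C> K x V y U"
      using co[OF conflation_objs(1)[OF P(2)]] by blast
    obtain M P' V' a b c d where M: "isomorphic \<C> P P'" "conflation \<C> P' a M b U"
      "isomorphic \<C> V V'" "conflation \<C> V' c M d C"
      using conflation_pushout[OF P(2) V(3)] .
    have "P' \<in> ?U"
      using subcategory_isomorphic[OF subcategory_left_perp[OF Defl_subset_Obj]
          projective_in_left_perp[OF Defl_subset_Obj P(1)] M(1)] .
    then have "M \<in> ?U"
      using closed_under_extensionsD[OF closed_under_extensions_left_perp[OF Defl_subset_Obj] M(2)] V(2)
      by blast
    then show ?thesis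
      using M(4) subcategory_isomorphic[OF subcategory_Defl V(1) M(3)] by blast
  qed
  moreover have "Ext_vanishes \<C> ?U ?V"
    unfolding Ext_vanishes_def using left_perpD by blast
  ultimately show ?thesis
    unfolding cotorsion_pair_def
    using co subcategory_Defl subcategory_left_perp[OF Defl_subset_Obj]
      closed_under_summands_left_perp[OF Defl_subset_Obj]
      closed_under_summands_if_closed_under_deflations[OF closed_under_deflations_Defl] by blast
qed

section \<open>Cotorsion pairs\<close>

lemma cotorsion_pairD:
  assumes "cotorsion_pair \<C> \<U> \<V>"
  shows "subcategory \<C> \<U>" "subcategory \<C> \<V>" "\<U> \<subseteq> Obj \<C>" "\<V> \<subseteq> Obj \<C>"
    "closed_under_summands \<C> \<U>" "closed_under_summands \<C> \<V>"
  using assms unfolding cotorsion_pair_def subcategory_def by blast+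

lemma cotorsion_pair_Ext:
  "\<lbrakk>cotorsion_pair \<C> \<U> \<V>; U \<in> \<U>; V \<in> \<V>\<rbrakk> \<Longrightarrow> trivial_Ext U V"
  unfolding cotorsion_pair_def Ext_vanishes_def by blast

lemma cotorsion_pair_resolution:
  assumes "cotorsion_pair \<C> \<U> \<V>" "C \<in> Obj \<C>"
  obtains V U x y where "V \<in> \<V>" "U \<in> \<U>" "conflation \<C> V x U y C"
  using assms unfolding cotorsion_pair_def by blast

lemma cotorsion_pair_coresolution:
  assumes "cotorsion_pair \<C> \<U> \<V>" "C \<in> Obj \<C>"
  obtains V U x y where "V \<in> \<V>" "U \<in> \<U>" "conflation \<C> C x V y U"
  using assms unfolding cotorsion_pair_def by blast

text \<open>
  If \<open>\<bbbE>(X, \<V>) = 0\<close>, then the right approximation of \<open>X\<close> splits, so \<open>X\<close> is a summand of an object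
  of \<open>\<U>\<close>.
\<close>

lemma cotorsion_pair_left_perp:
  assumes UV: "cotorsion_pair \<C> \<U> \<V>"
  shows "\<U> = left_perp \<C> \<V>"
proof (intro equalityI subsetI)
  fix X assume "X \<in> \<U>"
  then show "X \<in> left_perp \<C> \<V>"
    using cotorsion_pairD(3)[OF UV] cotorsion_pair_Ext[OF UV] unfolding left_perp_def by blast
next
  fix X assume X: "X \<in> left_perp \<C> \<V>"
  then have "X \<in> Obj \<C>" using left_perp_subset_Obj by blast
  then obtain V U x y where V: "V \<in> \<V>" "U \<in> \<U>" "conflation \<C> V x U y X"
    using cotorsion_pair_resolution[OF UV] by blast
  show "X \<in> \<U>"
    using split_conflation_summand(2)[OF cotorsion_pairD(5)[OF UV] V(3) left_perpD[OF X V(1)] V(2)] .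
qed

lemma cotorsion_pair_projective_coresolution:
  assumes UV: "cotorsion_pair \<C> \<U> \<V>" and P: "projective \<C> P"
  obtains V U x y where "V \<in> \<U> \<inter> \<V>" "U \<in> \<U>" "conflation \<C> P x V y U"
proof -
  have "P \<in> Obj \<C>" using P unfolding projective_def by simp
  then obtain V U x y where V: "V \<in> \<V>" "U \<in> \<U>" "conflation \<C> P x V y U"
    using cotorsion_pair_coresolution[OF UV] by blast
  have "P \<in> \<U>"
    using projective_in_left_perp[OF cotorsion_pairD(4)[OF UV] P] cotorsion_pair_left_perp[OF UV]
    by simp
  then have "V \<in> \<U>"
    using closed_under_extensionsD[OF closed_under_extensions_left_perp V(3)]
      cotorsion_pairD(4)[OF UV] cotorsion_pair_left_perp[OF UV] V(2) by blast
  then show thesis using that V by blast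
qed

lemma cotorsion_pair_imp_tau_cotorsion_pair:
  assumes UV: "cotorsion_pair \<C> \<U> \<V>"
  shows "tau_cotorsion_pair \<C> \<U> \<V>"
proof -
  have "\<exists>V \<in> \<U> \<inter> \<V>. \<exists>U \<in> \<U>. \<exists>f g.
      right_exact_triangle \<C> P f V g U \<and> left_approximation \<C> \<V> P f V" if P: "projective \<C> P" for P
  proof -
    obtain V U f g where V: "V \<in> \<U> \<inter> \<V>" "U \<in> \<U>" "conflation \<C> P f V g U"
      using cotorsion_pair_projective_coresolution[OF UV P] .
    have "left_approximation \<C> \<V> P f V"
      using inflation_left_approximation[OF V(3)] V(1) cotorsion_pair_Ext[OF UV V(2)] by blast
    then show ?thesis using V conflation_right_exact by blast
  qed
  then show ?thesis
    unfolding tau_cotorsion_pair_def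
    using cotorsion_pairD(1,2)[OF UV] cotorsion_pair_left_perp[OF UV] by blast
qed

lemma torsion_classD:
  assumes "torsion_class \<C> \<V>"
  shows "closed_under_extensions \<C> \<V>" "Defl \<C> \<V> = \<V>"
  using assms unfolding torsion_class_def closed_under_deflations_def by blast+

lemma torsion_class_conflation:
  "\<lbrakk>torsion_class \<C> \<V>; conflation \<C> A x B y C; B \<in> \<V>\<rbrakk> \<Longrightarrow> C \<in> \<V>"
  using Defl_conflation torsion_classD(2) by blast

text \<open>
  In the right approximation \<open>W \<rightarrow> U \<rightarrow> X\<close> of an object \<open>X\<close> of \<open>\<V>\<close>, the middle term is an extension
  of objects of \<open>\<V>\<close>.
\<close>

lemma cotorsion_torsion_Defl_inter:
  assumes UV: "cotorsion_pair \<C> \<U> \<V>" and V: "torsion_class \<C> \<V>"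
  shows "Defl \<C> (\<U> \<inter> \<V>) = \<V>"
proof (intro equalityI subsetI)
  fix X assume "X \<in> Defl \<C> (\<U> \<inter> \<V>)"
  then have "X \<in> Defl \<C> \<V>" unfolding Defl_def by blast
  then show "X \<in> \<V>" using torsion_classD(2)[OF V] by simp
next
  fix X assume X: "X \<in> \<V>"
  then have "X \<in> Obj \<C>" using cotorsion_pairD(4)[OF UV] by blast
  then obtain W U x y where W: "W \<in> \<V>" "U \<in> \<U>" "conflation \<C> W x U y X"
    using cotorsion_pair_resolution[OF UV] by blast
  have "U \<in> \<V>"
    using closed_under_extensionsD[OF torsion_classD(1)[OF V] W(3,1) X] .
  then have "U \<in> \<U> \<inter> \<V>"
    using W(2) by blast
  then show "X \<in> Defl \<C> (\<U> \<inter> \<V>)"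
    using DeflI conflation_objs(5)[OF W(3)] conflation_deflation[OF W(3)] by blast
qed

text \<open>
  For the first syzygy \<open>K\<close> of \<open>T\<close>, an extension of \<open>K\<close> by \<open>X\<close> comes from an arrow \<open>f : K \<rightarrow> Y\<close> to the
  cosyzygy \<open>Y\<close> of \<open>X\<close>. An injective \<open>I\<close> lies in \<open>\<V>\<close> because its left approximation splits, so its
  quotient \<open>Y\<close> lies in \<open>\<V>\<close> too. Then \<open>\<bbbE>(T, Y) = 0\<close> extends \<open>f\<close> to the projective \<open>P\<close>, and the
  extension is pulled back from an extension of \<open>P\<close>, hence zero.
\<close>

lemma cotorsion_torsion_pd_le_one:
  assumes ep: "enough_projectives \<C>" and ei: "enough_injectives \<C>"
    and UV: "cotorsion_pair \<C> \<U> \<V>" and V: "torsion_class \<C> \<V>" and T: "T \<in> \<U>"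
  shows "pd \<C> T \<le> 1"
proof -
  have "T \<in> Obj \<C>" using T cotorsion_pairD(3)[OF UV] by blast
  from enough_projectives_conflation[OF ep this]
  obtain K k P p where P: "projective \<C> P" "conflation \<C> K k P p T" .
  note o = conflation_objs[OF P(2)]
  have "projective \<C> K"
  proof (rule projective_if_trivial_Ext[OF o(1)], rule trivial_ExtI[OF o(1)])
    fix X \<delta> assume X: "X \<in> Obj \<C>" and \<delta>: "\<delta> \<in> carrier (Ext \<C> K X)"
    obtain I x y Y where I: "injective \<C> I" "conflation \<C> X x I y Y"
      using enough_injectives_conflation[OF ei X] .
    note oI = conflation_objs[OF I(2)]
    obtain W U u v where W: "W \<in> \<V>" "U \<in> \<U>" "conflation \<C> I u W v U"
      using cotorsion_pair_coresolution[OF UV oI(2)] .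
    have "I \<in> \<V>"
      using split_conflation_summand(1)[OF cotorsion_pairD(6)[OF UV] W(3)
          injective_trivial_Ext[OF I(1) conflation_objs(3)[OF W(3)]] W(1)] .
    then have Y: "Y \<in> \<V>"
      using torsion_class_conflation[OF V I(2)] by blast
    obtain \<theta> where \<theta>: "realizes \<C> \<theta> X x I y Y"
      using I(2) by (rule conflation_realizes)
    obtain f where f: "f \<in> Hom K Y" "\<delta> = pull \<C> X f \<theta>"
      using pull_of_connecting[OF \<theta> o(1) \<delta>
          trivial_ExtD[OF injective_trivial_Ext[OF I(1) o(1)] push_closed[OF o(1) oI(4) \<delta>]]] .
    obtain g where g: "g \<in> Hom P Y" "g \<cdot> k = f"
      using extend_if_trivial_Ext[OF P(2) cotorsion_pair_Ext[OF UV T Y] f(1)] .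
    note \<theta>' = realizes_objs(4)[OF \<theta>]
    have "\<delta> = pull \<C> X k (pull \<C> X g \<theta>)"
      using f(2) g(2) pull_pull[OF X g(1) o(4) \<theta>'] by simp
    also have "\<dots> = \<one>\<^bsub>Ext \<C> K X\<^esub>"
      using trivial_ExtD[OF projective_trivial_Ext[OF P(1) X] pull_closed[OF X g(1) \<theta>']]
        pull_one[OF X o(4)] by simp
    finally show "\<delta> = \<one>\<^bsub>Ext \<C> K X\<^esub>" .
  qed
  then show ?thesis using pd_le_oneI[OF P(2)] P(1) by blast
qed

lemma cotorsion_torsion_closed_under_finite_sums:
  assumes UV: "cotorsion_pair \<C> \<U> \<V>" and V: "torsion_class \<C> \<V>"
  shows "closed_under_finite_sums \<C> (\<U> \<inter> \<V>)"
proof -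
  have "Z \<in> \<U> \<inter> \<V>" if Z: "zero_object \<C> Z" for Z
  proof -
    have "Z \<in> Obj \<C>" using Z unfolding zero_object_def by simp
    then obtain W U x y where W: "W \<in> \<V>" "U \<in> \<U>" "conflation \<C> W x U y Z"
      using cotorsion_pair_resolution[OF UV] by blast
    have "Z \<in> \<V>"
      using torsion_class_conflation[OF V biproduct_conflation[OF biproduct_zero_right[OF Z]] W(1)]
        conflation_objs(1)[OF W(3)] by blast
    moreover have "Z \<in> \<U>"
      using projective_in_left_perp[OF cotorsion_pairD(4)[OF UV] zero_object_projective[OF Z]]
        cotorsion_pair_left_perp[OF UV] by simp
    ultimately show ?thesis by blast
  qed
  moreover have "S \<in> \<U> \<inter> \<V>"
    if S: "biproduct \<C> A B S i j p q" and AB: "A \<in> \<U> \<inter> \<V>" "B \<in> \<U> \<inter> \<V>" for A B S i j p q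
  proof -
    note c = biproduct_conflation[OF S]
    have "S \<in> \<V>"
      using closed_under_extensionsD[OF torsion_classD(1)[OF V] c] AB by blast
    moreover have "S \<in> \<U>"
      using closed_under_extensionsD[OF closed_under_extensions_left_perp c]
        cotorsion_pairD(4)[OF UV] cotorsion_pair_left_perp[OF UV] AB by blast
    ultimately show ?thesis by blast
  qed
  ultimately show ?thesis
    unfolding closed_under_finite_sums_def by blast
qed

lemma cotorsion_torsion_imp_tilting:
  assumes ep: "enough_projectives \<C>" and ei: "enough_injectives \<C>"
    and UV: "cotorsion_pair \<C> \<U> \<V>" and V: "torsion_class \<C> \<V>"
  shows "tilting \<C> (\<U> \<inter> \<V>)"
proof -
  have "subcategory \<C> (\<U> \<inter> \<V>)"
    using cotorsion_pairD(1,2)[OF UV] unfolding subcategory_def by blast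
  moreover have "closed_under_summands \<C> (\<U> \<inter> \<V>)"
    using cotorsion_pairD(5,6)[OF UV] unfolding closed_under_summands_def by blast
  moreover have "pd_subcategory \<C> (\<U> \<inter> \<V>) \<le> 1"
    unfolding pd_subcategory_def using cotorsion_torsion_pd_le_one[OF ep ei UV V]
    by (intro SUP_least) blast
  moreover have "Ext_vanishes \<C> (\<U> \<inter> \<V>) (\<U> \<inter> \<V>)"
    unfolding Ext_vanishes_def using cotorsion_pair_Ext[OF UV] by blast
  moreover have "\<exists>T0 \<in> \<U> \<inter> \<V>. \<exists>T1 \<in> \<U> \<inter> \<V>. \<exists>x y. conflation \<C> P x T0 y T1"
    if P: "projective \<C> P" for P
  proof -
    obtain T\<^sub>0 T\<^sub>1 x y where T: "T\<^sub>0 \<in> \<U> \<inter> \<V>" "T\<^sub>1 \<in> \<U>" "conflation \<C> P x T\<^sub>0 y T\<^sub>1"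
      using cotorsion_pair_projective_coresolution[OF UV P] .
    then show ?thesis using torsion_class_conflation[OF V T(3)] by blast
  qed
  ultimately show ?thesis
    unfolding tilting_def using cotorsion_torsion_closed_under_finite_sums[OF UV V] by blast
qed

end

theorem corollary3p13:
  fixes \<C> :: "('o, 'm, 'e) extri_data"
  assumes "extriangulated_category \<C>"
    and "krull_schmidt \<C>"
    and "enough_projectives \<C>"
    and "enough_injectives \<C>"
    and "WIC \<C>"
  defines "\<Phi> \<equiv> \<lambda>\<T>. (left_perp \<C> (Defl \<C> \<T>), Defl \<C> \<T>)"
    and "\<Psi> \<equiv> \<lambda>(\<U>, \<V>). \<U> \<inter> \<V>"
    and "Tilt \<equiv> {\<T>. tilting \<C> \<T>}"
    and "SuppTauTilt \<equiv> {\<T>. support_tau_tilting \<C> \<T>}"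
    and "CotorsTors \<equiv> {(\<U>, \<V>). cotorsion_pair \<C> \<U> \<V> \<and> torsion_class \<C> \<V>}"
    and "TauCotorsTors \<equiv> {(\<U>, \<V>). tau_cotorsion_pair \<C> \<U> \<V> \<and> torsion_class \<C> \<V>}"
  shows "Tilt \<subseteq> SuppTauTilt \<and> CotorsTors \<subseteq> TauCotorsTors \<and>
    bij_betw \<Phi> Tilt CotorsTors \<and> bij_betw \<Psi> CotorsTors Tilt \<and>
    (\<forall>\<T> \<in> Tilt. \<Psi> (\<Phi> \<T>) = \<T>) \<and> (\<forall>p \<in> CotorsTors. \<Phi> (\<Psi> p) = p)"
proof -
  interpret extriangulated_category \<C> by (rule assms(1))
  note ep = assms(3) and ei = assms(4)
  have "Tilt \<subseteq> SuppTauTilt"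
    unfolding Tilt_def SuppTauTilt_def using tilting_imp_support_tau_tilting[OF ep] by blast
  moreover have "CotorsTors \<subseteq> TauCotorsTors"
    unfolding CotorsTors_def TauCotorsTors_def using cotorsion_pair_imp_tau_cotorsion_pair by blast
  moreover have \<Phi>: "\<Phi> ` Tilt \<subseteq> CotorsTors"
    unfolding \<Phi>_def Tilt_def CotorsTors_def
    using tilting_imp_cotorsion_pair[OF ep] tilting_torsion_class[OF ep] by blast
  moreover have \<Psi>: "\<Psi> ` CotorsTors \<subseteq> Tilt"
    unfolding \<Psi>_def Tilt_def CotorsTors_def
    using cotorsion_torsion_imp_tilting[OF ep ei] by auto
  moreover have \<Psi>\<Phi>: "\<forall>\<T> \<in> Tilt. \<Psi> (\<Phi> \<T>) = \<T>"
    unfolding \<Phi>_def \<Psi>_def Tilt_def using tilting_left_perp_inter_Defl[OF ep] by simp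
  moreover have \<Phi>\<Psi>: "\<forall>p \<in> CotorsTors. \<Phi> (\<Psi> p) = p"
    unfolding \<Phi>_def \<Psi>_def CotorsTors_def
    using cotorsion_torsion_Defl_inter cotorsion_pair_left_perp by auto
  moreover have "bij_betw \<Phi> Tilt CotorsTors"
    using bij_betw_byWitness[OF \<Psi>\<Phi> \<Phi>\<Psi> \<Phi> \<Psi>] .
  moreover have "bij_betw \<Psi> CotorsTors Tilt"
    using bij_betw_byWitness[OF \<Phi>\<Psi> \<Psi>\<Phi> \<Psi> \<Phi>] .
  ultimately show ?thesis by blast
qed

end
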